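(* There exists an indecomposable $\aleph_1$-free abelian group of cardinality $\aleph_1$.
   Context: An abelian group is $\aleph_1$-free if all its countable subgroups are free abelian. A nonzero abelian group is indecomposable if it is not the direct sum of two nonzero subgroups. The statement is a theorem of ZFC (no continuum hypothesis is assumed). *)

theory Defs
  imports "HOL-Algebra.Algebra"
begin

text \<open>Abelian groups are written multiplicatively, as in \<^locale>\<open>comm_group\<close>.\<close>

text \<open>Taking the index set \<open>S\<close> in the element type of the group loses nothing: a basis of \<open>G\<close> is
  itself a subset of \<^term>\<open>carrier G\<close>.\<close>

definition free_abelian :: "('a, 'b) monoid_scheme \<Rightarrow> bool" where
  "free_abelian G \<longleftrightarrow> (\<exists>S :: 'a set. G \<cong> free_Abelian_group S)"

definition aleph1_free :: "('a, 'b) monoid_scheme \<Rightarrow> bool" where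
  "aleph1_free G \<longleftrightarrow>
     (\<forall>H. subgroup H G \<and> countable H \<longrightarrow> free_abelian (G\<lparr>carrier := H\<rparr>))"

definition internal_direct_sum :: "('a, 'b) monoid_scheme \<Rightarrow> 'a set \<Rightarrow> 'a set \<Rightarrow> bool" where
  "internal_direct_sum G A B \<longleftrightarrow>
     subgroup A G \<and> subgroup B G \<and> A \<inter> B = {\<one>\<^bsub>G\<^esub>} \<and> A <#>\<^bsub>G\<^esub> B = carrier G"

definition indecomposable :: "('a, 'b) monoid_scheme \<Rightarrow> bool" where
  "indecomposable G \<longleftrightarrow> carrier G \<noteq> {\<one>\<^bsub>G\<^esub>} \<and>
     \<not> (\<exists>A B. internal_direct_sum G A B \<and> A \<noteq> {\<one>\<^bsub>G\<^esub>} \<and> B \<noteq> {\<one>\<^bsub>G\<^esub>})"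

text \<open>\<^const>\<open>natLeq\<close> represents the cardinal aleph-0, so its cardinal successor is aleph-1.\<close>

definition has_card_aleph1 :: "'a set \<Rightarrow> bool" where
  "has_card_aleph1 A \<longleftrightarrow> (card_of A, cardSuc natLeq) \<in> ordIso"

end

theory Submission
  imports Defs
begin

text \<open>The group lies between a free group of countable rank and a rational vector space. Let \<open>B\<close> be free
on the nodes of the binary tree, with basis vectors \<open>e\<^sub>t\<close>. For each of \<open>\<aleph>\<^sub>1\<close> branches \<open>\<beta>\<close>
a vector \<open>y\<^sub>\<beta>\<close> is adjoined, together with enough quotients that every partial sum
\<open>\<Sum>i<n. Q i (e (\<beta>|i) + \<beta>(i) g\<^sub>\<beta>)\<close>
with \<open>Q i = 2 ^ (i * i)\<close> is congruent to \<open>y\<^sub>\<beta>\<close> modulo \<open>Q n\<close>. So \<open>y\<^sub>\<beta>\<close> stands for the infinite sum, which is a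
\<open>2\<close>-adic limit of elements of \<open>B\<close>. Here \<open>g\<^sub>\<beta> \<in> B\<close> is one of the countably many vectors
\<open>e\<^sub>s + e\<^sub>t\<close>, and each of these serves \<open>\<aleph>\<^sub>1\<close> branches, which form its class.

Every countable subgroup is free, since finitely many branches eventually separate: past that level
each of them owns nodes that no other one visits, and reading an element off at such nodes bounds
its denominators (\<open>bounded_denominators\<close>). In a countable subgroup this yields a triangular
basis (\<open>free_abelian_coords\<close>).

For indecomposability the point is that every endomorphism \<open>\<phi>\<close> maps each
\<open>g = e\<^sub>s + e\<^sub>t\<close> into its own rational line (\<open>endo_pair_sum\<close>). By the pigeonhole principle
there are two branches \<open>\<alpha>, \<alpha>'\<close> of the class of \<open>g\<close>, parting at a level \<open>n\<close>
above any prescribed height, whose images under \<open>\<phi>\<close> look alike up to that height. Since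
\<open>y\<^sub>\<alpha> - y\<^bsub>\<alpha>'\<^esub> \<equiv> \<plusminus> Q n g\<close> modulo \<open>Q (n + 1)\<close>, the difference of the images is
\<open>\<plusminus> Q n \<phi>(g)\<close> modulo \<open>Q (n + 1)\<close>. On the other hand it is a combination, with fixed
coefficients, of differences \<open>y\<^sub>\<beta> - y\<^bsub>\<beta>'\<^esub>\<close> of matched branches. If such a pair parted
below \<open>n\<close>, then a node just above its splitting level would betray it; if it parts above \<open>n\<close>, it
contributes nothing modulo \<open>Q (n + 1)\<close>; and if it parts exactly at \<open>n\<close>, then it belongs to the class
of \<open>g\<close>, because different classes split at disjoint sets of levels, and so it contributes a multiple
of \<open>Q n g\<close>. Hence \<open>\<phi>(g)\<close> is \<open>2\<close>-adically close to the line of \<open>g\<close>, and as \<open>n\<close> grows it lies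
on it (\<open>images_differ_along_line\<close>, \<open>line_criterion\<close>).

It follows that \<open>\<phi>\<close> acts on \<open>B\<close> as multiplication by one scalar, which is an idempotent
integer if \<open>\<phi>\<close> is a projection. So one of the two projections of a direct decomposition
vanishes on \<open>B\<close>; it then vanishes everywhere, because the group modulo \<open>B\<close> is \<open>2\<close>-divisible while no
nonzero element of the group is divisible by all powers of \<open>2\<close> (\<open>endo_zero\<close>).\<close>

section \<open>Groups with rational coordinates of bounded denominators\<close>

text \<open>A bounded denominator embeds the subgroup into the integers, so a least positive element
generates it.\<close>

lemma rat_lattice_cyclic:
  fixes Z :: "rat set" and D :: int
  assumes z0: "0 \<in> Z" and diff: "\<And>x y. x \<in> Z \<Longrightarrow> y \<in> Z \<Longrightarrow> x - y \<in> Z"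
    and D: "D \<noteq> 0" "\<And>x. x \<in> Z \<Longrightarrow> of_int D * x \<in> \<int>"
  shows "\<exists>d\<in>Z. \<forall>x\<in>Z. \<exists>k::int. x = of_int k * d"
proof (cases "Z = {0}")
  case True
  then show ?thesis by auto
next
  case False
  define W where "W = {n::nat. n > 0 \<and> of_nat n / of_int D \<in> Z}"
  have neg: "- x \<in> Z" if "x \<in> Z" for x
    using diff[OF z0 that] by simp
  have add: "x + y \<in> Z" if "x \<in> Z" "y \<in> Z" for x y
    using diff[OF that(1) neg[OF that(2)]] by simp
  have nmul: "of_nat k * x \<in> Z" if "x \<in> Z" for k x
    by (induction k) (auto simp: z0 algebra_simps intro: add that)
  have imul: "of_int k * x \<in> Z" if "x \<in> Z" for k x
    by (cases k) (auto simp del: of_nat_Suc intro: neg nmul that)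
  from False z0 obtain x where x: "x \<in> Z" "x \<noteq> 0" by auto
  from D(2)[OF x(1)] obtain k :: int where k: "of_int D * x = of_int k" by (auto elim: Ints_cases)
  have xk: "x = of_int k / of_int D" using k D(1) by (simp add: field_simps)
  have k0: "k \<noteq> 0" using x(2) xk by auto
  have "of_nat (nat \<bar>k\<bar>) / of_int D \<in> Z"
  proof (cases "k \<ge> 0")
    case True
    then show ?thesis using x(1) xk by simp
  next
    case False
    then have "of_nat (nat \<bar>k\<bar>) / of_int D = - x" using xk by simp
    then show ?thesis using neg[OF x(1)] by simp
  qed
  then have "nat \<bar>k\<bar> \<in> W" using k0 by (simp add: W_def)
  define m where "m = (LEAST n. n \<in> W)"
  have mW: "m \<in> W" unfolding m_def using \<open>nat \<bar>k\<bar> \<in> W\<close> by (rule LeastI)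
  define d :: rat where "d = of_nat m / of_int D"
  have dZ: "d \<in> Z" and m0: "m > 0" using mW by (auto simp: W_def d_def)
  have "\<exists>k::int. y = of_int k * d" if y: "y \<in> Z" for y
  proof -
    from D(2)[OF y] obtain l :: int where l: "of_int D * y = of_int l" by (auto elim: Ints_cases)
    have yl: "y = of_int l / of_int D" using l D(1) by (simp add: field_simps)
    define r where "r = l mod int m"
    have r: "0 \<le> r" "r < int m" using m0 by (auto simp: r_def)
    have "l = (l div int m) * int m + r" by (simp add: r_def)
    then have "of_int l = (of_int (l div int m) * of_nat m + of_int r :: rat)"
      by (metis of_int_add of_int_mult of_int_of_nat_eq)
    then have eq: "y - of_int (l div int m) * d = of_int r / of_int D"
      by (simp add: yl d_def diff_divide_distrib[symmetric])
    have "of_int r / of_int D \<in> Z" unfolding eq[symmetric] by (intro diff y imul dZ)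
    then have "nat r \<in> W" if "r \<noteq> 0" using that r by (simp add: W_def)
    moreover have "nat r \<notin> W"
      using not_less_Least[of "nat r" "\<lambda>n. n \<in> W"] r m0 unfolding m_def[symmetric] by auto
    ultimately have "r = 0" by blast
    then have "y = of_int (l div int m) * d" using eq by simp
    then show ?thesis by blast
  qed
  then show ?thesis using dZ by blast
qed

text \<open>The coordinates need not be integral. For each \<open>N\<close> the elements supported on \<open>{0,...,N}\<close> have
their \<open>N\<close>-th coordinates in a cyclic group; elements that realize the nonzero generators form a basis,
since reading the coordinates from the top makes the system triangular. The argument is the one that
shows subgroups of free groups of countable rank to be free.\<close>

lemma free_abelian_coords:
  fixes K :: "('a, 'b) monoid_scheme" and co :: "'a \<Rightarrow> nat \<Rightarrow> rat"
  assumes K: "comm_group K"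
    and add: "\<And>x y n. x \<in> carrier K \<Longrightarrow> y \<in> carrier K \<Longrightarrow> co (x \<otimes>\<^bsub>K\<^esub> y) n = co x n + co y n"
    and inj: "\<And>x. x \<in> carrier K \<Longrightarrow> (\<And>n. co x n = 0) \<Longrightarrow> x = \<one>\<^bsub>K\<^esub>"
    and fin: "\<And>x. x \<in> carrier K \<Longrightarrow> \<exists>N. \<forall>n\<ge>N. co x n = 0"
    and lat: "\<And>N. \<exists>D::int. D \<noteq> 0 \<and>
                 (\<forall>x\<in>carrier K. (\<forall>n>N. co x n = 0) \<longrightarrow> of_int D * co x N \<in> \<int>)"
  shows "free_abelian K"
proof -
  interpret comm_group K by (rule K)
  have co1: "co \<one>\<^bsub>K\<^esub> n = 0" for n using add[OF one_closed one_closed, of n] by simp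
  have coinv: "co (inv\<^bsub>K\<^esub> x) n = - co x n" if "x \<in> carrier K" for x n
    using add[OF that inv_closed[OF that], of n] that co1 by simp
  have cop: "co (x [^]\<^bsub>K\<^esub> (k::nat)) n = of_nat k * co x n" if "x \<in> carrier K" for x k n
    by (induction k) (simp_all add: co1 add that algebra_simps)
  have coip: "co (x [^]\<^bsub>K\<^esub> (k::int)) n = of_int k * co x n" if "x \<in> carrier K" for x k n
    by (cases "k < 0") (simp_all only: int_pow_def2 if_True if_False coinv[OF nat_pow_closed[OF that]] cop[OF that], simp_all)
  define C where "C N = {x \<in> carrier K. \<forall>n>N. co x n = 0}" for N
  have "\<exists>h. h \<in> C N \<and> (\<forall>x\<in>C N. \<exists>k::int. co x N = of_int k * co h N)" for N
  proof -
    obtain D :: int where D: "D \<noteq> 0" "\<And>x. x \<in> C N \<Longrightarrow> of_int D * co x N \<in> \<int>"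
      using lat[of N] unfolding C_def by auto
    have "\<exists>d\<in>(\<lambda>x. co x N) ` C N. \<forall>x\<in>(\<lambda>x. co x N) ` C N. \<exists>k::int. x = of_int k * d"
    proof (rule rat_lattice_cyclic[OF _ _ D(1)])
      show "0 \<in> (\<lambda>x. co x N) ` C N"
        by (rule image_eqI[of _ _ "\<one>\<^bsub>K\<^esub>"]) (auto simp: C_def co1)
      show "x - y \<in> (\<lambda>x. co x N) ` C N"
        if "x \<in> (\<lambda>x. co x N) ` C N" "y \<in> (\<lambda>x. co x N) ` C N" for x y
      proof -
        from that obtain a b where "a \<in> C N" "b \<in> C N" "x = co a N" "y = co b N" by auto
        then have "a \<otimes>\<^bsub>K\<^esub> inv\<^bsub>K\<^esub> b \<in> C N" "x - y = co (a \<otimes>\<^bsub>K\<^esub> inv\<^bsub>K\<^esub> b) N"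
          by (auto simp: C_def add coinv)
        then show ?thesis by blast
      qed
    qed (use D(2) in auto)
    then show ?thesis by auto
  qed
  then have "\<exists>h. \<forall>N. h N \<in> C N \<and> (\<forall>x\<in>C N. \<exists>k::int. co x N = of_int k * co (h N) N)"
    by (intro choice allI)
  then obtain h where h: "\<And>N. h N \<in> C N"
      and hgen: "\<And>N x. x \<in> C N \<Longrightarrow> \<exists>k::int. co x N = of_int k * co (h N) N"
    by blast
  have hK: "h N \<in> carrier K" for N using h[of N] by (simp add: C_def)
  have h0: "co (h N) n = 0" if "n > N" for n N using h[of N] that by (simp add: C_def)
  define M where "M = {N. co (h N) N \<noteq> 0}"
  define S where "S = h ` M"
  have hinj: "N = N'" if "N \<in> M" "N' \<in> M" "h N = h N'" for N N'
    using that h0[of N N'] h0[of N' N] unfolding M_def by (cases N N' rule: linorder_cases) auto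
  have "(\<lambda>x. x) ` S \<subseteq> carrier K" using hK by (auto simp: S_def)
  from free_Abelian_group_universal[OF this] obtain f where
    f: "f \<in> hom (free_Abelian_group S) K" and ff: "\<And>x. x \<in> S \<Longrightarrow> f (frag_of x) = x" by metis
  interpret f: group_hom "free_Abelian_group S" K f
    by (simp add: f group_hom_def group_hom_axioms_def is_group)
  have cof: "co (f c) n = (\<Sum>s\<in>Poly_Mapping.keys c. of_int (Poly_Mapping.lookup c s) * co s n)"
    if c: "c \<in> carrier (free_Abelian_group S)" for c n
  proof -
    have *: "(\<Sum>s\<in>Poly_Mapping.keys c. of_int (Poly_Mapping.lookup c s) * co s n)
       = (\<Sum>s\<in>A. of_int (Poly_Mapping.lookup c s) * co s n)" 
      if "finite A" "Poly_Mapping.keys c \<subseteq> A" for c A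
      using that by (intro sum.mono_neutral_left) (auto simp: in_keys_iff)
    have "Poly_Mapping.keys c \<subseteq> S" using c by simp
    then show ?thesis
    proof (induction c rule: free_Abelian_group_induct[consumes 1, case_names zero diff one])
      case zero
      then show ?case using f.hom_one co1 by simp
    next
      case (diff x y)
      let ?A = "Poly_Mapping.keys x \<union> Poly_Mapping.keys y"
      have kx: "x \<in> carrier (free_Abelian_group S)" "y \<in> carrier (free_Abelian_group S)"
        using diff by auto
      have kd: "Poly_Mapping.keys (x - y) \<subseteq> ?A" by (rule keys_diff)
      have "f (x - y) = f x \<otimes>\<^bsub>K\<^esub> inv\<^bsub>K\<^esub> f y"
        using f.hom_mult[OF kx(1) f.G.inv_closed[OF kx(2)]] f.hom_inv[OF kx(2)] kx
        by (simp del: f.hom_inv f.hom_mult)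
      then have "co (f (x - y)) n = co (f x) n - co (f y) n"
        using kx by (simp add: add coinv)
      also have "\<dots> = (\<Sum>s\<in>?A. of_int (Poly_Mapping.lookup x s) * co s n)
            - (\<Sum>s\<in>?A. of_int (Poly_Mapping.lookup y s) * co s n)"
        using diff by (simp add: *[of ?A])
      also have "\<dots> = (\<Sum>s\<in>?A. of_int (Poly_Mapping.lookup (x - y) s) * co s n)"
        by (simp add: lookup_minus sum_subtractf left_diff_distrib)
      also have "\<dots> = (\<Sum>s\<in>Poly_Mapping.keys (x - y). of_int (Poly_Mapping.lookup (x - y) s) * co s n)"
        by (rule *[symmetric, OF _ kd]) auto
      finally show ?case .
    next
      case (one a)
      then show ?case by (simp add: ff)
    qed
  qed
  have inj_f: "inj_on f (carrier (free_Abelian_group S))"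
  proof (rule f.inj_iff_trivial_ker[THEN iffD2])
    show "kernel (free_Abelian_group S) K f = {\<one>\<^bsub>free_Abelian_group S\<^esub>}"
    proof -
      have "c = 0" if c: "c \<in> carrier (free_Abelian_group S)" and fc: "f c = \<one>\<^bsub>K\<^esub>" for c
      proof (rule ccontr)
        assume "c \<noteq> 0"
        \<comment> \<open>The topmost basis element occurring in \<open>c\<close> cannot be cancelled.\<close>
        define L where "L = {N \<in> M. h N \<in> Poly_Mapping.keys c}"
        have kc: "Poly_Mapping.keys c = h ` L" using c by (auto simp: L_def S_def)
        have injL: "inj_on h L" by (auto simp: inj_on_def L_def intro: hinj)
        have finL: "finite L" using finite_imageD[OF _ injL] kc by (metis finite_keys)
        have "L \<noteq> {}" using \<open>c \<noteq> 0\<close> kc by auto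
        define N where "N = Max L"
        have NL: "N \<in> L" using finL \<open>L \<noteq> {}\<close> by (simp add: N_def)
        have "0 = co (f c) N" using fc co1 by simp
        also have "\<dots> = (\<Sum>s\<in>h ` L. of_int (Poly_Mapping.lookup c s) * co s N)"
          using cof[OF c] kc by simp
        also have "\<dots> = (\<Sum>n\<in>L. of_int (Poly_Mapping.lookup c (h n)) * co (h n) N)"
          by (simp add: sum.reindex[OF injL])
        also have "\<dots> = (\<Sum>n\<in>{N}. of_int (Poly_Mapping.lookup c (h n)) * co (h n) N)"
        proof (rule sum.mono_neutral_right[OF finL])
          show "\<forall>i\<in>L - {N}. of_int (Poly_Mapping.lookup c (h i)) * co (h i) N = 0"
          proof
            fix i assume i: "i \<in> L - {N}"
            then have "i < N" using finL by (auto simp: N_def order_less_le)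
            then show "of_int (Poly_Mapping.lookup c (h i)) * co (h i) N = 0" by (simp add: h0)
          qed
        qed (use NL in auto)
        also have "\<dots> \<noteq> 0" using NL by (auto simp: L_def M_def in_keys_iff)
        finally show False by simp
      qed
      then show ?thesis using f.hom_one by (auto simp: kernel_def)
    qed
  qed
  have "\<forall>x\<in>carrier K. (\<forall>n\<ge>N. co x n = 0) \<longrightarrow> x \<in> f ` carrier (free_Abelian_group S)" for N
  proof (induction N)
    case 0
    show ?case
    proof (intro ballI impI)
      fix x assume "x \<in> carrier K" "\<forall>n\<ge>0. co x n = 0"
      then have "x = f \<one>\<^bsub>free_Abelian_group S\<^esub>" using inj f.hom_one by simp
      then show "x \<in> f ` carrier (free_Abelian_group S)" by blast
    qed
  next
    case (Suc N)
    show ?case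
    proof (intro ballI impI)
      fix x assume x: "x \<in> carrier K" "\<forall>n\<ge>Suc N. co x n = 0"
      then have "x \<in> C N" by (simp add: C_def)
      then obtain k :: int where k: "co x N = of_int k * co (h N) N" using hgen by blast
      show "x \<in> f ` carrier (free_Abelian_group S)"
      proof (cases "N \<in> M")
        case False
        then have "co x N = 0" using k by (simp add: M_def)
        then have "\<forall>n\<ge>N. co x n = 0" using x(2) by (metis le_antisym not_less_eq_eq)
        then show ?thesis using Suc x(1) by blast
      next
        case True
        then have hS: "h N \<in> S" by (simp add: S_def)
        define y where "y = x \<otimes>\<^bsub>K\<^esub> (h N [^]\<^bsub>K\<^esub> (- k))"
        have yK: "y \<in> carrier K" using x(1) hK by (simp add: y_def)
        have coy: "co y n = co x n - of_int k * co (h N) n" for n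
          using x(1) hK unfolding y_def by (subst add) (auto simp: coip simp del: int_pow_neg)
        have "co y n = 0" if "n \<ge> N" for n
          using that x(2) coy[of n] k h0[of N n] by (cases "n = N") auto
        then have "y \<in> f ` carrier (free_Abelian_group S)" using Suc yK by blast
        then obtain c where c: "c \<in> carrier (free_Abelian_group S)" "y = f c" by blast
        have hc: "frag_of (h N) \<in> carrier (free_Abelian_group S)" using hS by simp
        have "x = y \<otimes>\<^bsub>K\<^esub> (h N [^]\<^bsub>K\<^esub> k)"
          unfolding y_def using x(1) hK by (simp add: m_assoc int_pow_neg)
        also have "\<dots> = f c \<otimes>\<^bsub>K\<^esub> f (frag_of (h N) [^]\<^bsub>free_Abelian_group S\<^esub> k)"
          using f.hom_int_pow[OF hc, of k] ff[OF hS] c by simp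
        also have "\<dots> = f (c \<otimes>\<^bsub>free_Abelian_group S\<^esub> (frag_of (h N) [^]\<^bsub>free_Abelian_group S\<^esub> k))"
          by (rule f.hom_mult[symmetric, OF c(1) f.G.int_pow_closed[OF hc]])
        finally show ?thesis using f.G.m_closed[OF c(1) f.G.int_pow_closed[OF hc, of k]] by blast
      qed
    qed
  qed
  then have surj: "carrier K \<subseteq> f ` carrier (free_Abelian_group S)" using fin by blast
  have "f \<in> iso (free_Abelian_group S) K"
    unfolding iso_def bij_betw_def using f inj_f surj f.hom_closed by auto
  then have "free_Abelian_group S \<cong> K" by (auto simp: is_iso_def)
  then have "K \<cong> free_Abelian_group S" by (simp add: f.G.iso_sym)
  then show ?thesis unfolding free_abelian_def by blast
qed

section \<open>Powers of two dividing rationals\<close>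

text \<open>Divisibility by a power of two in the integers, but applied to rationals: integrality is part of the
predicate. All approximation arguments are \<open>2\<close>-adic and are phrased with it.\<close>

definition pow2_dvd :: "nat \<Rightarrow> rat \<Rightarrow> bool" where
  "pow2_dvd e x \<longleftrightarrow> (\<exists>k::int. x = 2 ^ e * of_int k)"

lemma pow2_dvd_0_iff: "pow2_dvd 0 x \<longleftrightarrow> x \<in> \<int>"
  by (auto simp: pow2_dvd_def elim: Ints_cases)

lemma pow2_dvd_zero [simp]: "pow2_dvd e 0"
  unfolding pow2_dvd_def by (rule exI[of _ 0]) simp

lemma pow2_dvd_add: "pow2_dvd e x \<Longrightarrow> pow2_dvd e y \<Longrightarrow> pow2_dvd e (x + y)"
  unfolding pow2_dvd_def by (metis distrib_left of_int_add)

lemma pow2_dvd_diff: "pow2_dvd e x \<Longrightarrow> pow2_dvd e y \<Longrightarrow> pow2_dvd e (x - y)"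
  unfolding pow2_dvd_def by (metis right_diff_distrib of_int_diff)

lemma pow2_dvd_int_mult: "pow2_dvd e x \<Longrightarrow> k \<in> \<int> \<Longrightarrow> pow2_dvd e (k * x)"
  unfolding pow2_dvd_def by (elim exE Ints_cases) (metis mult.left_commute of_int_mult)

lemma pow2_dvd_mono: "pow2_dvd f x \<Longrightarrow> e \<le> f \<Longrightarrow> pow2_dvd e x"
  unfolding pow2_dvd_def
proof (elim exE)
  fix k :: int assume "x = 2 ^ f * of_int k" "e \<le> f"
  then have "x = 2 ^ e * of_int (2 ^ (f - e) * k)" by (simp flip: power_add mult.assoc)
  then show "\<exists>k::int. x = 2 ^ e * of_int k" by blast
qed

lemma pow2_dvd_power: "e \<le> f \<Longrightarrow> pow2_dvd e (2 ^ f)"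
  by (rule pow2_dvd_mono[of f]) (auto simp: pow2_dvd_def intro: exI[of _ 1])

lemma pow2_dvd_sum: "(\<And>i. i \<in> A \<Longrightarrow> pow2_dvd e (f i)) \<Longrightarrow> pow2_dvd e (sum f A)"
  by (induction A rule: infinite_finite_induct) (auto intro: pow2_dvd_add)

lemma pow2_dvd_cancel: "pow2_dvd (e + f) (2 ^ e * x) \<Longrightarrow> pow2_dvd f x"
  unfolding pow2_dvd_def by (simp add: power_add)

lemma pow2_dvd_small: "pow2_dvd e x \<Longrightarrow> \<bar>x\<bar> < 2 ^ e \<Longrightarrow> x = 0"
  unfolding pow2_dvd_def
proof (elim exE)
  fix k :: int assume x: "x = 2 ^ e * of_int k" and "\<bar>x\<bar> < 2 ^ e"
  then have "2 ^ e * \<bar>of_int k :: rat\<bar> < 2 ^ e * 1" by (simp add: abs_mult)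
  then have "\<bar>of_int k :: rat\<bar> < 1" by (subst (asm) mult_less_cancel_left_pos) auto
  then have "\<bar>k\<bar> < 1" by (metis of_int_1 of_int_abs of_int_less_iff)
  then show "x = 0" using x by simp
qed

lemma rat_less_pow2: "\<exists>e::nat. (x::rat) < 2 ^ e"
proof -
  obtain n :: nat where "x < of_nat n" using reals_Archimedean2 by blast
  also have "of_nat n < (2 ^ n :: rat)"
    by (metis of_nat_less_iff of_nat_numeral of_nat_power less_exp)
  finally show ?thesis by blast
qed

lemma pow2_dvd_unbounded:
  assumes "\<And>K. \<exists>e\<ge>K. pow2_dvd e x" shows "x = 0"
proof -
  obtain K where K: "\<bar>x\<bar> < 2 ^ K" using rat_less_pow2 by blast
  with assms[of K] show ?thesis using pow2_dvd_mono pow2_dvd_small by blast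
qed

text \<open>The square in the exponent makes \<open>Q (n + 1)/Q n\<close> a growing power of two, so that a coefficient
chosen in advance is eventually not divisible by the next quotient.\<close>

definition Q :: "nat \<Rightarrow> rat" where "Q n = 2 ^ (n * n)"

lemma Q_nonzero [simp]: "Q n \<noteq> 0" and Q_Ints [simp]: "Q n \<in> \<int>"
  by (auto simp: Q_def)

lemma Q_dvd: "m \<le> n \<Longrightarrow> pow2_dvd (m * m) (Q n)"
  unfolding Q_def by (intro pow2_dvd_power mult_mono) auto

section \<open>The group of a system of branches\<close>

text \<open>Agreeing entries are admitted, which gives \<open>2 e\<^sub>t\<close>; the vectors \<open>e\<^sub>s + e\<^sub>t\<close> with \<open>s \<noteq> t\<close> are
what ties together the scalars of different nodes.\<close>

definition pair_sum :: "bool list \<times> bool list \<Rightarrow> bool list \<Rightarrow> rat" where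
  "pair_sum p t = of_bool (t = fst p) + of_bool (t = snd p)"

lemma pair_sum_Ints [simp]: "pair_sum p t \<in> \<int>"
  by (auto simp: pair_sum_def)

definition beyond :: "bool list \<times> bool list \<Rightarrow> nat \<Rightarrow> bool" where
  "beyond p n \<longleftrightarrow> length (fst p) < n \<and> length (snd p) < n"

lemma pair_sum_beyond: "beyond p n \<Longrightarrow> n \<le> length t \<Longrightarrow> pair_sum p t = 0"
  by (auto simp: pair_sum_def beyond_def)

lemma uncountable_fiber:
  assumes "uncountable A" "countable (f ` A)"
  shows "\<exists>v. uncountable {a \<in> A. f a = v}"
proof (rule ccontr)
  assume "\<nexists>v. uncountable {a \<in> A. f a = v}"
  then have "countable (\<Union>v\<in>f ` A. {a \<in> A. f a = v})" using assms(2) by (intro countable_UN) auto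
  moreover have "(\<Union>v\<in>f ` A. {a \<in> A. f a = v}) = A" by auto
  ultimately show False using assms(1) by simp
qed

text \<open>Used with \<open>f\<close> and \<open>g\<close> recording what is visible of a branch at some level, to match
the branches occurring in two elements that cannot be told apart.\<close>

lemma bij_from_equal_images:
  assumes "inj_on f A" "inj_on g B" "f ` A = g ` B"
  shows "\<exists>\<sigma>. bij_betw \<sigma> A B \<and> (\<forall>a\<in>A. g (\<sigma> a) = f a)"
proof (intro exI conjI ballI)
  have "bij_betw f A (g ` B)" using assms by (simp add: bij_betw_def)
  moreover have "bij_betw (inv_into B g) (g ` B) B"
    using assms by (simp add: bij_betw_inv_into bij_betw_def inj_on_inv_into)
  ultimately show "bij_betw (inv_into B g \<circ> f) A B" by (rule bij_betw_trans)
  show "g ((inv_into B g \<circ> f) a) = f a" if "a \<in> A" for a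
    using that assms(3) by (metis comp_apply f_inv_into_f image_eqI)
qed

text \<open>The two splitting conditions separate the effects of different branches. Classes split on disjoint
sets of levels, so that two pairs which part at the same level share their vector \<open>g\<close>; and no two
splitting levels are adjacent, so that the node directly above a splitting level can be tested
before the next splitting interferes.\<close>

locale branches =
  fixes I :: "'i set" and bit :: "'i \<Rightarrow> nat \<Rightarrow> bool" and cls :: "'i \<Rightarrow> bool list \<times> bool list"
  assumes bit_inj: "\<lbrakk>\<beta> \<in> I; \<gamma> \<in> I; bit \<beta> = bit \<gamma>\<rbrakk> \<Longrightarrow> \<beta> = \<gamma>"
    and split_even: "\<lbrakk>cls \<beta> = cls \<gamma>; bit \<beta> n \<noteq> bit \<gamma> n\<rbrakk> \<Longrightarrow> even n"
    and split_cls: "\<lbrakk>cls \<beta> = cls \<beta>'; bit \<beta> n \<noteq> bit \<beta>' n; cls \<gamma> = cls \<gamma>'; bit \<gamma> n \<noteq> bit \<gamma>' n\<rbrakk>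
                      \<Longrightarrow> cls \<beta> = cls \<gamma>"
    and uncountable_cls: "uncountable {\<beta> \<in> I. cls \<beta> = p}"
begin

definition trunc :: "'i \<Rightarrow> nat \<Rightarrow> bool list" where "trunc \<beta> n = map (bit \<beta>) [0..<n]"

lemma length_trunc [simp]: "length (trunc \<beta> n) = n"
  by (simp add: trunc_def)

lemma trunc_eq_iff: "trunc \<beta> n = trunc \<gamma> n \<longleftrightarrow> (\<forall>i<n. bit \<beta> i = bit \<gamma> i)"
  by (auto simp: trunc_def)

definition bit_weight :: "nat \<Rightarrow> 'i \<Rightarrow> rat" where "bit_weight n \<beta> = (\<Sum>i<n. of_bool (bit \<beta> i) * Q i)"

definition path_part :: "nat \<Rightarrow> 'i \<Rightarrow> bool list \<Rightarrow> rat" where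
  "path_part n \<beta> t = (if length t < n \<and> t = trunc \<beta> (length t) then Q (length t) else 0)"

text \<open>The coefficient of \<open>e\<^sub>t\<close> in \<open>\<Sum>i<n. Q i (e (\<beta>|i) + \<beta>(i) g\<^sub>\<beta>)\<close>: at most one \<open>i\<close>
contributes through the path, namely the length of \<open>t\<close>.\<close>

definition psum :: "nat \<Rightarrow> 'i \<Rightarrow> bool list \<Rightarrow> rat" where
  "psum n \<beta> t = path_part n \<beta> t + bit_weight n \<beta> * pair_sum (cls \<beta>) t"

lemma psum_0 [simp]: "psum 0 \<beta> t = 0"
  by (simp add: psum_def path_part_def bit_weight_def)

lemma bit_weight_diff:
  assumes "n \<le> N" shows "pow2_dvd (n * n) (bit_weight N \<beta> - bit_weight n \<beta>)"
proof -
  have "bit_weight N \<beta> - bit_weight n \<beta> = (\<Sum>i\<in>{n..<N}. of_bool (bit \<beta> i) * Q i)"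
    unfolding bit_weight_def lessThan_atLeast0 by (rule sum_diff_nat_ivl) (use assms in auto)
  then show ?thesis by (auto intro!: pow2_dvd_sum pow2_dvd_int_mult Q_dvd)
qed

lemma psum_diff:
  assumes "n \<le> N" shows "pow2_dvd (n * n) (psum N \<beta> t - psum n \<beta> t)"
proof -
  have "psum N \<beta> t - psum n \<beta> t = (path_part N \<beta> t - path_part n \<beta> t) + pair_sum (cls \<beta>) t * (bit_weight N \<beta> - bit_weight n \<beta>)"
    by (simp add: psum_def algebra_simps)
  moreover have "pow2_dvd (n * n) (path_part N \<beta> t - path_part n \<beta> t)"
    using assms by (auto simp: path_part_def intro: Q_dvd)
  ultimately show ?thesis
    using pow2_dvd_add pow2_dvd_int_mult[OF bit_weight_diff[OF assms] pair_sum_Ints] by metis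
qed

lemma psum_Ints: "psum n \<beta> t \<in> \<int>"
  using psum_diff[of 0 n \<beta> t] by (simp add: pow2_dvd_0_iff)

text \<open>Up to \<open>n\<close> the paths agree, and what lies above is divisible by \<open>Q (n + 1)\<close>; only the switch at level
\<open>n\<close> itself remains visible. The node on the path at level \<open>n\<close> is still shared, since it records the
bits below \<open>n\<close> only.\<close>

lemma psum_split:
  assumes cls: "cls \<beta> = cls \<gamma>" and agree: "\<And>i. i < n \<Longrightarrow> bit \<beta> i = bit \<gamma> i" and "n < N"
  shows "pow2_dvd (Suc n * Suc n) (psum N \<beta> t - psum N \<gamma> t
           - (of_bool (bit \<beta> n) - of_bool (bit \<gamma> n)) * Q n * pair_sum (cls \<beta>) t)"
proof -
  let ?e = "Suc n * Suc n"
  have bit_weight_n: "bit_weight n \<beta> = bit_weight n \<gamma>" using agree by (simp add: bit_weight_def)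
  have bit_weight_Suc: "bit_weight (Suc n) \<delta> = bit_weight n \<delta> + of_bool (bit \<delta> n) * Q n" for \<delta>
    by (simp add: bit_weight_def)
  have nd: "pow2_dvd ?e (path_part N \<beta> t - path_part N \<gamma> t)"
  proof (cases "length t \<le> n")
    case True
    then have "trunc \<beta> (length t) = trunc \<gamma> (length t)" using agree by (simp add: trunc_eq_iff)
    then show ?thesis by (simp add: path_part_def)
  next
    case False
    then have "pow2_dvd ?e (Q (length t))" by (intro Q_dvd) simp
    then show ?thesis unfolding path_part_def by (intro pow2_dvd_diff) auto
  qed
  have "pow2_dvd ?e (pair_sum (cls \<beta>) t * ((bit_weight N \<beta> - bit_weight (Suc n) \<beta>) - (bit_weight N \<gamma> - bit_weight (Suc n) \<gamma>)))"
    using \<open>n < N\<close> by (intro pow2_dvd_int_mult pow2_dvd_diff bit_weight_diff) auto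
  from pow2_dvd_add[OF nd this] show ?thesis
    by (simp add: psum_def cls bit_weight_Suc bit_weight_n algebra_simps)
qed

text \<open>Elements are written in the rational basis of all \<open>e\<^sub>t\<close> (\<open>Inl\<close>) and \<open>y\<^sub>\<beta>\<close> (\<open>Inr\<close>).
Put \<open>y\<^sub>\<beta>\<^sup>n = (y\<^sub>\<beta> - \<Sum>i<n. Q i (e (\<beta>|i) + \<beta>(i) g\<^sub>\<beta>)) / Q n\<close>. Then
\<open>ncoord n x t\<close> is the coordinate of \<open>x\<close> at \<open>e\<^sub>t\<close> with respect to the basis of all \<open>e\<^sub>t\<close> and
\<open>y\<^sub>\<beta>\<^sup>n\<close>; the coordinate at \<open>y\<^sub>\<beta>\<^sup>n\<close> is \<open>Q n x\<^sub>\<beta>\<close>. As \<open>n\<close> grows, these values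
approximate a \<open>2\<close>-adic integer, the value of \<open>x\<close> at the node \<open>t\<close>.\<close>

definition ncoord :: "nat \<Rightarrow> (bool list + 'i \<Rightarrow> rat) \<Rightarrow> bool list \<Rightarrow> rat" where
  "ncoord n x t = x (Inl t) + (\<Sum>\<beta> | x (Inr \<beta>) \<noteq> 0. x (Inr \<beta>) * psum n \<beta> t)"

lemma finite_Inr_supp: "finite {a. x a \<noteq> 0} \<Longrightarrow> finite {\<beta>. x (Inr \<beta>) \<noteq> 0}"
  using finite_vimageI[of "{a. x a \<noteq> 0}" Inr] by (simp add: vimage_def)

lemma ncoord_eq:
  assumes "finite R" "\<And>\<beta>. \<beta> \<notin> R \<Longrightarrow> x (Inr \<beta>) = 0"
  shows "ncoord n x t = x (Inl t) + (\<Sum>\<beta>\<in>R. x (Inr \<beta>) * psum n \<beta> t)"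
  unfolding ncoord_def using assms by (intro arg_cong2[of _ _ _ _ "(+)"] sum.mono_neutral_left refl) auto

lemma ncoord_lin:
  assumes "finite {a. x a \<noteq> 0}" "finite {a. y a \<noteq> 0}"
  shows "ncoord n (\<lambda>a. c * x a + d * y a) t = c * ncoord n x t + d * ncoord n y t"
proof -
  define R where "R = {\<beta>. x (Inr \<beta>) \<noteq> 0} \<union> {\<beta>. y (Inr \<beta>) \<noteq> 0}"
  have R: "finite R" using assms by (simp add: R_def finite_Inr_supp)
  have "ncoord n x t = x (Inl t) + (\<Sum>\<beta>\<in>R. x (Inr \<beta>) * psum n \<beta> t)"
    by (rule ncoord_eq[OF R]) (auto simp: R_def)
  moreover have "ncoord n y t = y (Inl t) + (\<Sum>\<beta>\<in>R. y (Inr \<beta>) * psum n \<beta> t)"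
    by (rule ncoord_eq[OF R]) (auto simp: R_def)
  moreover have "ncoord n (\<lambda>a. c * x a + d * y a) t = (c * x (Inl t) + d * y (Inl t))
      + (\<Sum>\<beta>\<in>R. (c * x (Inr \<beta>) + d * y (Inr \<beta>)) * psum n \<beta> t)"
    by (rule ncoord_eq[OF R]) (auto simp: R_def)
  ultimately show ?thesis by (simp add: sum.distrib sum_distrib_left algebra_simps)
qed

text \<open>The free group spanned by the \<open>e\<^sub>t\<close> and the \<open>y\<^sub>\<beta>\<^sup>n\<close>, with \<open>\<beta> \<in> I\<close>, described by the
integrality of coordinates.\<close>

definition stage :: "nat \<Rightarrow> (bool list + 'i \<Rightarrow> rat) set" where
  "stage n = {x. finite {a. x a \<noteq> 0} \<and> (\<forall>\<beta>. \<beta> \<notin> I \<longrightarrow> x (Inr \<beta>) = 0) \<and>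
             (\<forall>\<beta>. Q n * x (Inr \<beta>) \<in> \<int>) \<and> (\<forall>t. ncoord n x t \<in> \<int>)}"

lemma ncoord_diff_Ints:
  assumes "finite {a. x a \<noteq> 0}" "\<And>\<beta>. Q n * x (Inr \<beta>) \<in> \<int>" "n \<le> N"
  shows "ncoord N x t - ncoord n x t \<in> \<int>"
proof -
  have "ncoord N x t - ncoord n x t
      = (\<Sum>\<beta> | x (Inr \<beta>) \<noteq> 0. x (Inr \<beta>) * (psum N \<beta> t - psum n \<beta> t))"
    by (simp add: ncoord_def sum_subtractf right_diff_distrib)
  also have "\<dots> \<in> \<int>"
  proof (rule Ints_sum)
    fix \<beta>
    obtain k :: int where "psum N \<beta> t - psum n \<beta> t = 2 ^ (n * n) * of_int k"
      using psum_diff[OF \<open>n \<le> N\<close>] by (auto simp: pow2_dvd_def)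
    then have "x (Inr \<beta>) * (psum N \<beta> t - psum n \<beta> t) = (Q n * x (Inr \<beta>)) * of_int k"
      by (simp add: Q_def)
    then show "x (Inr \<beta>) * (psum N \<beta> t - psum n \<beta> t) \<in> \<int>"
      using Ints_mult[OF assms(2)[of \<beta>] Ints_of_int[of k]] by (simp only:)
  qed
  finally show ?thesis .
qed

lemma stage_mono: assumes "x \<in> stage n" "n \<le> N" shows "x \<in> stage N"
proof -
  have "Q N * x (Inr \<beta>) \<in> \<int>" for \<beta>
  proof -
    obtain k :: int where "Q N = 2 ^ (n * n) * of_int k"
      using Q_dvd[OF \<open>n \<le> N\<close>] by (auto simp: pow2_dvd_def)
    then have "Q N * x (Inr \<beta>) = of_int k * (Q n * x (Inr \<beta>))" by (simp add: Q_def)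
    moreover have "of_int k * (Q n * x (Inr \<beta>)) \<in> \<int>"
      by (rule Ints_mult[OF Ints_of_int]) (use assms(1) in \<open>simp add: stage_def\<close>)
    ultimately show ?thesis by (simp only:)
  qed
  moreover have "ncoord N x t \<in> \<int>" for t
  proof -
    have "ncoord N x t = (ncoord N x t - ncoord n x t) + ncoord n x t" by simp
    also have "\<dots> \<in> \<int>" using assms by (intro Ints_add ncoord_diff_Ints) (auto simp: stage_def)
    finally show ?thesis .
  qed
  ultimately show ?thesis using assms(1) by (simp add: stage_def)
qed

definition branch_group :: "(bool list + 'i \<Rightarrow> rat) set" where "branch_group = (\<Union>n. stage n)"

lemma stage_in_branch_group: "x \<in> stage n \<Longrightarrow> x \<in> branch_group" by (auto simp: branch_group_def)

lemma branch_group_supp: "x \<in> branch_group \<Longrightarrow> finite {a. x a \<noteq> 0}"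
  and branch_group_I: "x \<in> branch_group \<Longrightarrow> x (Inr \<beta>) \<noteq> 0 \<Longrightarrow> \<beta> \<in> I"
  by (auto simp: branch_group_def stage_def)

lemma branch_group_level: "x \<in> branch_group \<Longrightarrow> \<exists>m. \<forall>N\<ge>m. x \<in> stage N"
  unfolding branch_group_def using stage_mono by auto

lemma finite_supp_lin:
  fixes x y :: "'c \<Rightarrow> rat"
  assumes "finite {a. x a \<noteq> 0}" "finite {a. y a \<noteq> 0}"
  shows "finite {a. c * x a + d * y a \<noteq> 0}"
  by (rule finite_subset[of _ "{a. x a \<noteq> 0} \<union> {a. y a \<noteq> 0}"]) (use assms in auto)

lemma stage_lin:
  assumes "x \<in> stage n" "y \<in> stage n" "c \<in> \<int>" "d \<in> \<int>"
  shows "(\<lambda>a. c * x a + d * y a) \<in> stage n"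
proof -
  have fin: "finite {a. x a \<noteq> 0}" "finite {a. y a \<noteq> 0}" using assms by (auto simp: stage_def)
  have "Q n * (c * x (Inr \<beta>) + d * y (Inr \<beta>)) \<in> \<int>" for \<beta>
  proof -
    have "Q n * (c * x (Inr \<beta>) + d * y (Inr \<beta>)) = c * (Q n * x (Inr \<beta>)) + d * (Q n * y (Inr \<beta>))"
      by (simp add: algebra_simps)
    then show ?thesis using assms by (simp add: stage_def)
  qed
  then show ?thesis
    using assms by (simp add: stage_def ncoord_lin[OF fin] finite_supp_lin[OF fin])
qed

lemma branch_group_lin:
  assumes "x \<in> branch_group" "y \<in> branch_group" "c \<in> \<int>" "d \<in> \<int>"
  shows "(\<lambda>a. c * x a + d * y a) \<in> branch_group"
proof -
  obtain m m' where "\<forall>N\<ge>m. x \<in> stage N" "\<forall>N\<ge>m'. y \<in> stage N" using assms branch_group_level by meson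
  then have "x \<in> stage (max m m')" "y \<in> stage (max m m')" by auto
  from stage_in_branch_group[OF stage_lin[OF this assms(3,4)]] show ?thesis .
qed

lemma branch_group_add: "x \<in> branch_group \<Longrightarrow> y \<in> branch_group \<Longrightarrow> (\<lambda>a. x a + y a) \<in> branch_group"
  using branch_group_lin[of x y 1 1] by simp

lemma branch_group_scale: "x \<in> branch_group \<Longrightarrow> c \<in> \<int> \<Longrightarrow> (\<lambda>a. c * x a) \<in> branch_group"
  using branch_group_lin[of x x c 0] by simp

section \<open>Separation, bounded denominators and approximation\<close>

text \<open>A level past which the supports of finitely many basis vectors no longer interact: the nodes
among them, and the vectors \<open>g\<close> of the branches among them, live below it, and the branches have
parted.\<close>

definition separating :: "(bool list + 'i) set \<Rightarrow> nat \<Rightarrow> bool" where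
  "separating S n \<longleftrightarrow> (\<forall>t. Inl t \<in> S \<longrightarrow> length t < n) \<and> (\<forall>\<beta>. Inr \<beta> \<in> S \<longrightarrow> beyond (cls \<beta>) n) \<and>
     (\<forall>\<beta> \<gamma>. Inr \<beta> \<in> S \<longrightarrow> Inr \<gamma> \<in> S \<longrightarrow> \<beta> \<noteq> \<gamma> \<longrightarrow> trunc \<beta> n \<noteq> trunc \<gamma> n)"

lemma separating_mono: "separating S n \<Longrightarrow> n \<le> m \<Longrightarrow> separating S m"
  unfolding separating_def trunc_eq_iff beyond_def by (meson order_less_le_trans)

lemma separating_exists:
  assumes fin: "finite S" and I: "\<And>\<beta>. Inr \<beta> \<in> S \<Longrightarrow> \<beta> \<in> I"
  shows "\<exists>n. separating S n"
proof -
  have ev: "\<forall>\<^sub>F n in sequentially. trunc \<beta> n \<noteq> trunc \<gamma> n"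
    if "Inr \<beta> \<in> S" "Inr \<gamma> \<in> S" "\<beta> \<noteq> \<gamma>" for \<beta> \<gamma>
  proof -
    have "bit \<beta> \<noteq> bit \<gamma>" using bit_inj[OF I I, of \<beta> \<gamma>] that by blast
    then obtain i where "bit \<beta> i \<noteq> bit \<gamma> i" by blast
    then show ?thesis
      by (intro eventually_mono[OF eventually_gt_at_top[of i]]) (auto simp: trunc_eq_iff)
  qed
  have 1: "\<forall>\<^sub>F n in sequentially. \<forall>a\<in>S. \<forall>b\<in>S. \<forall>\<beta> \<gamma>. a = Inr \<beta> \<longrightarrow> b = Inr \<gamma> \<longrightarrow> \<beta> \<noteq> \<gamma> \<longrightarrow>
        trunc \<beta> n \<noteq> trunc \<gamma> n"
  proof (intro eventually_ball_finite ballI fin)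
    fix a b assume ab: "a \<in> S" "b \<in> S"
    show "\<forall>\<^sub>F n in sequentially. \<forall>\<beta> \<gamma>. a = Inr \<beta> \<longrightarrow> b = Inr \<gamma> \<longrightarrow> \<beta> \<noteq> \<gamma> \<longrightarrow> trunc \<beta> n \<noteq> trunc \<gamma> n"
    proof (cases "\<exists>\<beta> \<gamma>. a = Inr \<beta> \<and> b = Inr \<gamma> \<and> \<beta> \<noteq> \<gamma>")
      case True
      then show ?thesis using ab by (auto intro!: ev)
    next
      case False
      then show ?thesis by (intro always_eventually) blast
    qed
  qed
  have 2: "\<forall>\<^sub>F n in sequentially. \<forall>a\<in>S. (\<forall>t. a = Inl t \<longrightarrow> length t < n) \<and>
              (\<forall>\<beta>. a = Inr \<beta> \<longrightarrow> beyond (cls \<beta>) n)"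
  proof (intro eventually_ball_finite ballI fin)
    fix a :: "bool list + 'i"
    show "\<forall>\<^sub>F n in sequentially. (\<forall>t. a = Inl t \<longrightarrow> length t < n) \<and>
              (\<forall>\<beta>. a = Inr \<beta> \<longrightarrow> beyond (cls \<beta>) n)"
    proof (cases a)
      case (Inl t)
      then show ?thesis using eventually_gt_at_top[of "length t"] by simp
    next
      case (Inr \<beta>)
      then show ?thesis
        using eventually_conj[OF eventually_gt_at_top[of "length (fst (cls \<beta>))"]
            eventually_gt_at_top[of "length (snd (cls \<beta>))"]]
        by (simp add: beyond_def)
    qed
  qed
  have "\<forall>\<^sub>F n in sequentially. separating S n"
    using eventually_conj[OF 1 2] by (rule eventually_mono) (auto simp: separating_def)
  then show ?thesis using eventually_happens' sequentially_bot by blast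
qed

text \<open>At a node that \<open>\<beta>\<close> alone visits and that lies beyond all the vectors \<open>g\<close> involved, the partial
sum of \<open>y\<^sub>\<beta>\<close> contributes exactly \<open>Q n\<close>.\<close>

lemma ncoord_node:
  assumes fin: "finite {a. x a \<noteq> 0}" and "n < N" and x0: "x (Inl (trunc \<beta> n)) = 0"
    and sep: "\<And>\<gamma>. x (Inr \<gamma>) \<noteq> 0 \<Longrightarrow> \<gamma> \<noteq> \<beta> \<Longrightarrow> trunc \<gamma> n \<noteq> trunc \<beta> n"
    and beyond: "\<And>\<gamma>. x (Inr \<gamma>) \<noteq> 0 \<Longrightarrow> beyond (cls \<gamma>) n"
  shows "ncoord N x (trunc \<beta> n) = x (Inr \<beta>) * Q n"
proof -
  let ?R = "insert \<beta> {\<gamma>. x (Inr \<gamma>) \<noteq> 0}"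
  have "x (Inr \<gamma>) * psum N \<gamma> (trunc \<beta> n) = (if \<gamma> = \<beta> then x (Inr \<beta>) * Q n else 0)" for \<gamma>
    using sep[of \<gamma>] pair_sum_beyond[OF beyond, of \<gamma> "trunc \<beta> n"] \<open>n < N\<close>
    by (cases "x (Inr \<gamma>) = 0"; cases "\<gamma> = \<beta>") (auto simp: psum_def path_part_def)
  then have "(\<Sum>\<gamma>\<in>?R. x (Inr \<gamma>) * psum N \<gamma> (trunc \<beta> n)) = x (Inr \<beta>) * Q n"
    using finite_Inr_supp[OF fin] by simp
  moreover have "ncoord N x (trunc \<beta> n) = x (Inl (trunc \<beta> n)) + (\<Sum>\<gamma>\<in>?R. x (Inr \<gamma>) * psum N \<gamma> (trunc \<beta> n))"
    by (rule ncoord_eq) (use finite_Inr_supp[OF fin] in auto)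
  ultimately show ?thesis using x0 by simp
qed

text \<open>For a separating level \<open>m\<close>, the values at the nodes of level \<open>m\<close> show that \<open>Q m\<close> clears the
denominators at the branches; the element then lies in the \<open>m\<close>-th stage already.\<close>

lemma bounded_denominators:
  assumes "finite S"
  shows "\<exists>D::int. D \<noteq> 0 \<and> (\<forall>x\<in>branch_group. (\<forall>a. a \<notin> S \<longrightarrow> x a = 0) \<longrightarrow> (\<forall>a. of_int D * x a \<in> \<int>))"
proof -
  \<comment> \<open>Branches outside \<open>I\<close> carry no coordinate, and separation is available for branches in \<open>I\<close> only.\<close>
  define S' where "S' = {a \<in> S. \<forall>\<beta>. a = Inr \<beta> \<longrightarrow> \<beta> \<in> I}"
  have "finite S'" and "\<And>\<beta>. Inr \<beta> \<in> S' \<Longrightarrow> \<beta> \<in> I"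
    using assms by (simp_all add: S'_def)
  then obtain m where m: "separating S' m" using separating_exists by metis
  have "(2 ^ (m * m) :: int) \<noteq> 0" by simp
  moreover have "of_int (2 ^ (m * m)) * x a \<in> \<int>"
    if x: "x \<in> branch_group" and xS: "\<And>a. a \<notin> S \<Longrightarrow> x a = 0" for x a
  proof -
    have xS': "a \<in> S'" if "x a \<noteq> 0" for a
      using that xS branch_group_I[OF x] unfolding S'_def by blast
    have fin: "finite {a. x a \<noteq> 0}" using x by (rule branch_group_supp)
    obtain N where N: "x \<in> stage N" "N > m"
    proof -
      obtain m' where "\<forall>N\<ge>m'. x \<in> stage N" using branch_group_level[OF x] by blast
      then have "x \<in> stage (max m' (Suc m))" "max m' (Suc m) > m" by auto
      then show ?thesis by (rule that)
    qed
    have Qx: "Q m * x (Inr \<beta>) \<in> \<int>" for \<beta>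
    proof (cases "x (Inr \<beta>) = 0")
      case False
      then have \<beta>: "Inr \<beta> \<in> S'" by (rule xS')
      have "ncoord N x (trunc \<beta> m) = x (Inr \<beta>) * Q m"
      proof (rule ncoord_node[OF fin N(2)])
        show "x (Inl (trunc \<beta> m)) = 0"
          using m xS'[of "Inl (trunc \<beta> m)"] by (force simp: separating_def)
      qed (use m \<beta> xS' in \<open>auto simp: separating_def\<close>)
      moreover have "ncoord N x (trunc \<beta> m) \<in> \<int>" using N by (simp add: stage_def)
      ultimately show ?thesis by (simp add: mult.commute)
    qed simp
    have "ncoord N x t - (ncoord N x t - ncoord m x t) \<in> \<int>" for t
      using N Qx fin by (intro Ints_diff ncoord_diff_Ints) (auto simp: stage_def)
    then have km: "ncoord m x t \<in> \<int>" for t by simp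
    have "Q m * x a \<in> \<int>"
    proof (cases a)
      case (Inr \<beta>)
      then show ?thesis using Qx by simp
    next
      case (Inl t)
      have "Q m * x a = Q m * ncoord m x t - (\<Sum>\<beta> | x (Inr \<beta>) \<noteq> 0. (Q m * x (Inr \<beta>)) * psum m \<beta> t)"
        by (simp add: Inl ncoord_def sum_distrib_left algebra_simps)
      also have "\<dots> \<in> \<int>" 
          by (intro Ints_diff Ints_sum Ints_mult[OF Qx psum_Ints] Ints_mult[OF Q_Ints km])
      finally show ?thesis .
    qed
    then show ?thesis by (simp add: Q_def)
  qed
  ultimately show ?thesis by blast
qed

text \<open>The parameter \<open>a\<close> may change with \<open>n\<close>, so the hypothesis says that \<open>Mp\<close> comes \<open>2\<close>-adically close
to the line through \<open>g\<close>. Deep nodes, where \<open>g\<close> vanishes, rule out a component of \<open>p\<close> at any branch; then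
the coordinates of \<open>p\<close> are constant rationals, and congruences modulo all powers of two become
equations. The last two conclusions put \<open>p\<close> on the line if \<open>g\<close> is \<open>e\<^sub>s + e\<^sub>t\<close>.\<close>

lemma line_criterion:
  assumes p: "p \<in> branch_group" and "M \<noteq> 0" and g: "\<And>t. l \<le> length t \<Longrightarrow> g t = 0"
    and approx: "\<And>K. \<exists>n\<ge>K. \<exists>a. \<exists>N0. \<forall>N\<ge>N0. \<forall>t. pow2_dvd n (M * ncoord N p t - a * g t)"
  shows "p (Inr \<beta>) = 0" and "g t = 0 \<Longrightarrow> p (Inl t) = 0" and "g t = g t' \<Longrightarrow> p (Inl t) = p (Inl t')"
proof -
  have fin: "finite {a. p a \<noteq> 0}" using p by (rule branch_group_supp)
  obtain m0 where "separating {a. p a \<noteq> 0} m0"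
    using separating_exists[OF fin] branch_group_I[OF p] by blast
  then have m: "separating {a. p a \<noteq> 0} (max m0 l)" by (rule separating_mono) simp
  define m where "m = max m0 l"
  show p0: "p (Inr \<beta>) = 0" for \<beta>
  proof (rule ccontr)
    assume \<beta>: "p (Inr \<beta>) \<noteq> 0"
    have "M * (p (Inr \<beta>) * Q m) = 0"
    proof (rule pow2_dvd_unbounded)
      fix K
      obtain n a N0 where n: "n \<ge> K" "\<And>N t. N \<ge> N0 \<Longrightarrow> pow2_dvd n (M * ncoord N p t - a * g t)"
        using approx[of K] by metis
      define N where "N = max N0 (Suc m)"
      have "ncoord N p (trunc \<beta> m) = p (Inr \<beta>) * Q m"
      proof (rule ncoord_node[OF fin])
        show "p (Inl (trunc \<beta> m)) = 0"
          using m unfolding m_def[symmetric] by (force simp: separating_def)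
      qed (use m \<beta> in \<open>auto simp: separating_def m_def[symmetric] N_def\<close>)
      moreover have "g (trunc \<beta> m) = 0" by (rule g) (simp add: m_def)
      moreover have "pow2_dvd n (M * ncoord N p (trunc \<beta> m) - a * g (trunc \<beta> m))"
        by (rule n(2)) (simp add: N_def)
      ultimately show "\<exists>e\<ge>K. pow2_dvd e (M * (p (Inr \<beta>) * Q m))" using n(1) by auto
    qed
    then show False using \<beta> \<open>M \<noteq> 0\<close> by simp
  qed
  have ncoord: "ncoord N p t = p (Inl t)" for N t by (simp add: ncoord_def p0)
  show "p (Inl t) = 0" if "g t = 0"
  proof -
    have "M * p (Inl t) = 0"
    proof (rule pow2_dvd_unbounded)
      fix K
      obtain n a N0 where "n \<ge> K" "\<And>N t. N \<ge> N0 \<Longrightarrow> pow2_dvd n (M * ncoord N p t - a * g t)"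
        using approx[of K] by metis
      from this(1) this(2)[of N0 t] that show "\<exists>e\<ge>K. pow2_dvd e (M * p (Inl t))"
        by (auto simp: ncoord)
    qed
    then show ?thesis using \<open>M \<noteq> 0\<close> by simp
  qed
  show "p (Inl t) = p (Inl t')" if "g t = g t'"
  proof -
    have "M * (p (Inl t) - p (Inl t')) = 0"
    proof (rule pow2_dvd_unbounded)
      fix K
      obtain n a N0 where n: "n \<ge> K" "\<And>N t. N \<ge> N0 \<Longrightarrow> pow2_dvd n (M * ncoord N p t - a * g t)"
        using approx[of K] by metis
      from pow2_dvd_diff[OF n(2)[of N0 t] n(2)[of N0 t']] n(1) that
      show "\<exists>e\<ge>K. pow2_dvd e (M * (p (Inl t) - p (Inl t')))"
        by (auto simp: ncoord algebra_simps)
    qed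
    then show ?thesis using \<open>M \<noteq> 0\<close> by simp
  qed
qed

text \<open>The case \<open>g = 0\<close> of the preceding criterion.\<close>

lemma divisible_zero:
  assumes x: "x \<in> branch_group" and div: "\<And>n::nat. \<exists>w\<in>branch_group. x = (\<lambda>a. 2 ^ n * w a)"
  shows "x = (\<lambda>_. 0)"
proof -
  have *: "\<exists>n\<ge>K. \<exists>a. \<exists>N0. \<forall>N\<ge>N0. \<forall>t. pow2_dvd n (1 * ncoord N x t - a * (\<lambda>_. 0) t)" for K
  proof -
    obtain w where w: "w \<in> branch_group" "x = (\<lambda>a. 2 ^ K * w a)" using div by blast
    obtain m where m: "\<forall>N\<ge>m. w \<in> stage N" using branch_group_level[OF w(1)] by blast
    have "pow2_dvd K (ncoord N x t)" if "N \<ge> m" for N t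
    proof -
      have "ncoord N x t = 2 ^ K * ncoord N w t"
        using ncoord_lin[OF branch_group_supp[OF w(1)] branch_group_supp[OF w(1)], of N "2 ^ K" 0 t] by (simp add: w(2))
      moreover have "ncoord N w t \<in> \<int>" using m that by (simp add: stage_def)
      ultimately show ?thesis by (auto simp: pow2_dvd_def elim: Ints_cases)
    qed
    then show ?thesis by auto
  qed
  have "x a = 0" for a
    using line_criterion(1,2)[OF x _ _ *, of 0] by (cases a) auto
  then show ?thesis by auto
qed

section \<open>Endomorphisms\<close>

definition node_vec :: "bool list \<Rightarrow> bool list + 'i \<Rightarrow> rat" where "node_vec t a = of_bool (a = Inl t)"

definition branch_vec :: "'i \<Rightarrow> bool list + 'i \<Rightarrow> rat" where "branch_vec \<beta> a = of_bool (a = Inr \<beta>)"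

definition of_nodes :: "(bool list \<Rightarrow> rat) \<Rightarrow> bool list + 'i \<Rightarrow> rat" where
  "of_nodes b a = (case a of Inl t \<Rightarrow> b t | Inr _ \<Rightarrow> 0)"

lemma node_vec_simps [simp]: "node_vec t (Inl s) = of_bool (s = t)" "node_vec t (Inr \<beta>) = 0"
  by (auto simp: node_vec_def)

lemma branch_vec_simps [simp]: "branch_vec \<beta> (Inl s) = 0" "branch_vec \<beta> (Inr \<gamma>) = of_bool (\<gamma> = \<beta>)"
  by (auto simp: branch_vec_def)

lemma of_nodes_simps [simp]: "of_nodes b (Inl s) = b s" "of_nodes b (Inr \<gamma>) = 0"
  by (auto simp: of_nodes_def)

lemma ncoord_of_nodes [simp]: "ncoord n (of_nodes b) t = b t"
  by (simp add: ncoord_def)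

lemma ncoord_branch_vec [simp]: "ncoord n (branch_vec \<beta>) t = psum n \<beta> t"
  using ncoord_eq[of "{\<beta>}" "branch_vec \<beta>" n t] by simp

lemma finite_supp_of_nodes: "finite {t. b t \<noteq> 0} \<Longrightarrow> finite {a. of_nodes b a \<noteq> 0}"
proof (rule finite_subset[of _ "Inl ` {t. b t \<noteq> 0}"])
  show "{a. of_nodes b a \<noteq> 0} \<subseteq> Inl ` {t. b t \<noteq> 0}"
  proof
    fix a assume "a \<in> {a. of_nodes b a \<noteq> 0}"
    then show "a \<in> Inl ` {t. b t \<noteq> 0}" by (cases a) auto
  qed
qed simp

lemma finite_supp_branch_vec: "finite {a. branch_vec \<beta> a \<noteq> 0}"
  by (rule finite_subset[of _ "{Inr \<beta>}"]) (auto simp: branch_vec_def)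

lemma of_nodes_branch_group: "finite {t. b t \<noteq> 0} \<Longrightarrow> (\<And>t. b t \<in> \<int>) \<Longrightarrow> of_nodes b \<in> branch_group"
  by (rule stage_in_branch_group[of _ 0]) (auto simp: stage_def finite_supp_of_nodes)

lemma branch_vec_branch_group: "\<beta> \<in> I \<Longrightarrow> branch_vec \<beta> \<in> branch_group"
  by (rule stage_in_branch_group[of _ 0]) (auto simp: stage_def finite_supp_branch_vec)

lemma node_vec_of_nodes: "node_vec t = of_nodes (\<lambda>s. of_bool (s = t))"
  by (rule ext) (auto simp: node_vec_def of_nodes_def split: sum.splits)

lemma node_vec_branch_group: "node_vec t \<in> branch_group"
  unfolding node_vec_of_nodes by (rule of_nodes_branch_group) (auto intro: finite_subset[of _ "{t}"])

lemma finite_pair_sum: "finite {t. pair_sum p t \<noteq> 0}"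
  by (rule finite_subset[of _ "{fst p, snd p}"]) (auto simp: pair_sum_def)

lemma pair_sum_branch_group: "of_nodes (pair_sum p) \<in> branch_group"
  by (rule of_nodes_branch_group[OF finite_pair_sum]) simp

definition endo :: "((bool list + 'i \<Rightarrow> rat) \<Rightarrow> (bool list + 'i \<Rightarrow> rat)) \<Rightarrow> bool" where
  "endo \<phi> \<longleftrightarrow> (\<forall>x\<in>branch_group. \<phi> x \<in> branch_group) \<and> (\<forall>x\<in>branch_group. \<forall>y\<in>branch_group. \<phi> (\<lambda>a. x a + y a) = (\<lambda>a. \<phi> x a + \<phi> y a))"

lemma endo_branch_group: "endo \<phi> \<Longrightarrow> x \<in> branch_group \<Longrightarrow> \<phi> x \<in> branch_group"
  by (simp add: endo_def)

lemma endo_add: "endo \<phi> \<Longrightarrow> x \<in> branch_group \<Longrightarrow> y \<in> branch_group \<Longrightarrow> \<phi> (\<lambda>a. x a + y a) a = \<phi> x a + \<phi> y a"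
  by (simp add: endo_def)

lemma branch_group_zero: "(\<lambda>_. 0) \<in> branch_group"
  using branch_group_scale[OF node_vec_branch_group, of 0] by simp

lemma endo_scale:
  assumes "endo \<phi>" "x \<in> branch_group" "c \<in> \<int>" shows "\<phi> (\<lambda>a. c * x a) a = c * \<phi> x a"
proof -
  have zero: "\<phi> (\<lambda>_. 0) a = 0" for a
    using endo_add[OF assms(1) branch_group_zero branch_group_zero, of a] by simp
  have nat: "\<phi> (\<lambda>a. of_nat k * x a) a = of_nat k * \<phi> x a" for k a
  proof (induction k)
    case (Suc k)
    have "(\<lambda>a. of_nat k * x a) \<in> branch_group" using assms(2) by (simp add: branch_group_scale)
    from endo_add[OF assms(1) assms(2) this, of a] Suc show ?case by (simp add: algebra_simps)
  qed (simp add: zero)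
  obtain k :: int where k: "c = of_int k" using assms(3) by (auto elim: Ints_cases)
  show ?thesis
  proof (cases "k \<ge> 0")
    case True
    then show ?thesis using nat[of "nat k"] k by simp
  next
    case False
    then have c: "c = - of_nat (nat (- k))" using k by simp
    have "(\<lambda>a. of_nat (nat (- k)) * x a) \<in> branch_group" "(\<lambda>a. c * x a) \<in> branch_group"
      using assms by (auto intro!: branch_group_scale)
    from endo_add[OF assms(1) this, of a] zero[of a] nat[of "nat (- k)" a] show ?thesis
      by (simp add: c)
  qed
qed

lemma endo_lin:
  assumes "endo \<phi>" "x \<in> branch_group" "y \<in> branch_group" "c \<in> \<int>" "d \<in> \<int>"
  shows "\<phi> (\<lambda>a. c * x a + d * y a) a = c * \<phi> x a + d * \<phi> y a"
  using endo_add[OF assms(1) branch_group_scale[OF assms(2,4)] branch_group_scale[OF assms(3,5)], of a]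
    endo_scale[OF assms(1,2,4)] endo_scale[OF assms(1,3,5)] by simp

text \<open>Here \<open>z\<close> and \<open>z'\<close> are the images of two branch vectors of the class \<open>q\<close> that part at
level \<open>n\<close>, \<open>p\<close> is the image of \<open>g\<close>, and \<open>\<sigma>\<close> matches the branches occurring in
\<open>z\<close> with those in \<open>z'\<close>. It is essential that \<open>m\<close> does not depend on \<open>n\<close>:
the factor \<open>Q m\<close> clears the denominators of the coefficients of \<open>z\<close>.\<close>

lemma images_differ_along_line:
  assumes z: "z \<in> stage m" and z': "z' \<in> branch_group" and "m \<le> K" and "K \<le> n" and "even n"
    and sep: "separating {a. z a \<noteq> 0} K"
    and sep': "separating {a. z' a \<noteq> 0} K"
    and small: "\<And>\<beta>. \<bar>z (Inr \<beta>)\<bar> < 2 ^ K"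
    and Inl: "\<And>t. z (Inl t) = z' (Inl t)"
    and bij: "bij_betw \<sigma> {\<beta>. z (Inr \<beta>) \<noteq> 0} {\<beta>. z' (Inr \<beta>) \<noteq> 0}"
    and \<sigma>: "\<And>\<beta>. z (Inr \<beta>) \<noteq> 0 \<Longrightarrow> trunc (\<sigma> \<beta>) K = trunc \<beta> K \<and> cls (\<sigma> \<beta>) = cls \<beta> \<and> z' (Inr (\<sigma> \<beta>)) = z (Inr \<beta>)"
    and cls_n: "\<And>\<beta>. z (Inr \<beta>) \<noteq> 0 \<Longrightarrow> bit \<beta> n \<noteq> bit (\<sigma> \<beta>) n \<Longrightarrow> cls \<beta> = q"
    and p: "p \<in> branch_group" and w: "w \<in> branch_group"
    and eq: "\<And>a. z a - z' a = Q n * p a + Q (Suc n) * w a"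
  shows "\<exists>a. \<exists>N0. \<forall>N\<ge>N0. \<forall>t. pow2_dvd n (Q m * ncoord N p t - a * pair_sum q t)"
proof -
  have finz: "finite {a. z a \<noteq> 0}" and finz': "finite {a. z' a \<noteq> 0}"
    using z z' branch_group_supp stage_in_branch_group by blast+
  define d where "d a = z a - z' a" for a
  have d_eq: "d = (\<lambda>a. 1 * z a + (- 1) * z' a)" "d = (\<lambda>a. Q n * p a + Q (Suc n) * w a)"
    by (auto simp: d_def eq)
  have find: "finite {a. d a \<noteq> 0}"
    unfolding d_eq(1) by (rule finite_supp_lin[OF finz finz'])
  have ncoord_d: "ncoord N d t = Q n * ncoord N p t + Q (Suc n) * ncoord N w t" for N t
    unfolding d_eq(2) by (rule ncoord_lin[OF branch_group_supp[OF p] branch_group_supp[OF w]])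
  obtain m1 m2 where m1: "\<And>N. N \<ge> m1 \<Longrightarrow> p \<in> stage N" and m2: "\<And>N. N \<ge> m2 \<Longrightarrow> w \<in> stage N"
    using branch_group_level p w by meson
  define N0 where "N0 = max (Suc n) (max m1 m2)"
  have kp: "ncoord N p t \<in> \<int>" and kw: "ncoord N w t \<in> \<int>" and nN: "n < N" if "N \<ge> N0" for N t
    using that m1[of N] m2[of N] by (auto simp: N0_def stage_def)
  have agree: "bit \<beta> i = bit (\<sigma> \<beta>) i" if \<beta>: "z (Inr \<beta>) \<noteq> 0" and "i < n" for \<beta> i
  proof (rule ccontr)
    assume neq: "bit \<beta> i \<noteq> bit (\<sigma> \<beta>) i"
    have "K \<le> i" using \<sigma>[OF \<beta>] neq by (metis not_le trunc_eq_iff)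
    have "even i" using split_even[OF _ neq] \<sigma>[OF \<beta>] by simp
    \<comment> \<open>Parity: the two levels differ by at least two, so \<open>d\<close> is divisible by \<open>Q (i + 2)\<close> while the node above level \<open>i\<close> shows \<open>Q (i + 1)\<close>.\<close>
    then have "Suc (Suc i) \<le> n" using \<open>i < n\<close> \<open>even n\<close> by (metis Suc_leI even_Suc le_neq_implies_less)
    have sepi: "separating {a. z a \<noteq> 0} (Suc i)" "separating {a. z' a \<noteq> 0} (Suc i)"
      using separating_mono[OF sep] separating_mono[OF sep'] \<open>K \<le> i\<close> by auto
    have other: "trunc \<gamma> (Suc i) \<noteq> trunc \<beta> (Suc i)" if \<gamma>: "z' (Inr \<gamma>) \<noteq> 0" for \<gamma>
    proof -
      obtain \<delta> where \<delta>: "\<gamma> = \<sigma> \<delta>" "z (Inr \<delta>) \<noteq> 0"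
        using bij \<gamma> by (auto simp: bij_betw_def)
      show ?thesis
      proof (cases "\<delta> = \<beta>")
        case True
        then show ?thesis using neq \<delta> by (auto simp: trunc_eq_iff)
      next
        case False
        then have "trunc \<delta> K \<noteq> trunc \<beta> K" using sep \<delta> \<beta> by (auto simp: separating_def)
        then have "trunc \<gamma> K \<noteq> trunc \<beta> K" using \<sigma>[OF \<delta>(2)] \<delta>(1) by simp
        then show ?thesis using \<open>K \<le> i\<close> unfolding trunc_eq_iff by (meson le_SucI order_less_le_trans)
      qed
    qed
    have "z' (Inr \<beta>) = 0" using other by blast
    have "ncoord N0 d (trunc \<beta> (Suc i)) = d (Inr \<beta>) * Q (Suc i)"
    proof (rule ncoord_node[OF find])
      show "Suc i < N0" using \<open>i < n\<close> by (simp add: N0_def)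
      show "d (Inl (trunc \<beta> (Suc i))) = 0" by (simp add: d_def Inl)
      fix \<gamma> assume "d (Inr \<gamma>) \<noteq> 0"
      then have \<gamma>: "z (Inr \<gamma>) \<noteq> 0 \<or> z' (Inr \<gamma>) \<noteq> 0" by (auto simp: d_def)
      then show "beyond (cls \<gamma>) (Suc i)" using sepi unfolding separating_def by blast
      show "trunc \<gamma> (Suc i) \<noteq> trunc \<beta> (Suc i)" if "\<gamma> \<noteq> \<beta>"
        using \<gamma> other that sepi(1) \<beta> unfolding separating_def by blast
    qed
    then have "ncoord N0 d (trunc \<beta> (Suc i)) = Q (Suc i) * z (Inr \<beta>)"
      by (simp add: d_def \<open>z' (Inr \<beta>) = 0\<close>)
    moreover have "pow2_dvd (Suc (Suc i) * Suc (Suc i)) (ncoord N0 d (trunc \<beta> (Suc i)))"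
      unfolding ncoord_d mult.commute[of "Q _"]
      by (intro pow2_dvd_add pow2_dvd_int_mult Q_dvd kp kw order_refl)
         (use \<open>Suc (Suc i) \<le> n\<close> in simp_all)
    ultimately have "pow2_dvd (Suc i * Suc i + (2 * i + 3)) (2 ^ (Suc i * Suc i) * z (Inr \<beta>))"
      by (simp add: Q_def algebra_simps numeral_3_eq_3)
    then have "pow2_dvd (2 * i + 3) (z (Inr \<beta>))" by (rule pow2_dvd_cancel)
    then have "pow2_dvd K (z (Inr \<beta>))" by (rule pow2_dvd_mono) (use \<open>K \<le> i\<close> in simp)
    then show False using pow2_dvd_small small \<beta> by blast
  qed
  define R where "R = {\<beta>. z (Inr \<beta>) \<noteq> 0}"
  \<comment> \<open>The sign with which the pair switches at level \<open>n\<close>; zero if it parts later or never.\<close>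
  define sw where "sw \<beta> = (of_bool (bit \<beta> n) - of_bool (bit (\<sigma> \<beta>) n) :: rat)" for \<beta>
  define a where "a = Q m * (\<Sum>\<beta>\<in>R. z (Inr \<beta>) * sw \<beta>)"
  have "pow2_dvd n (Q m * ncoord N p t - a * pair_sum q t)" if "N \<ge> N0" for N t
  proof -
    let ?e = "Suc n * Suc n"
    have "(\<Sum>\<beta>\<in>{\<beta>. z' (Inr \<beta>) \<noteq> 0}. z' (Inr \<beta>) * psum N \<beta> t)
        = (\<Sum>\<beta>\<in>R. z' (Inr (\<sigma> \<beta>)) * psum N (\<sigma> \<beta>) t)"
      unfolding R_def by (rule sum.reindex_bij_betw[OF bij, symmetric])
    also have "\<dots> = (\<Sum>\<beta>\<in>R. z (Inr \<beta>) * psum N (\<sigma> \<beta>) t)"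
      by (intro sum.cong refl) (use \<sigma> in \<open>simp add: R_def\<close>)
    finally have kd: "ncoord N d t = (\<Sum>\<beta>\<in>R. z (Inr \<beta>) * (psum N \<beta> t - psum N (\<sigma> \<beta>) t))"
      unfolding d_eq(1) ncoord_lin[OF finz finz']
      by (simp add: ncoord_def Inl R_def right_diff_distrib sum_subtractf)
    have "Q m * ncoord N d t - a * (Q n * pair_sum q t)
       = (\<Sum>\<beta>\<in>R. (Q m * z (Inr \<beta>)) * (psum N \<beta> t - psum N (\<sigma> \<beta>) t - sw \<beta> * Q n * pair_sum q t))"
      unfolding kd a_def by (simp add: sum_distrib_left sum_distrib_right sum_subtractf[symmetric] algebra_simps)
    also have "pow2_dvd ?e \<dots>"
    proof (intro pow2_dvd_sum pow2_dvd_int_mult)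
      fix \<beta> assume "\<beta> \<in> R"
      then have \<beta>: "z (Inr \<beta>) \<noteq> 0" by (simp add: R_def)
      show "Q m * z (Inr \<beta>) \<in> \<int>" using z by (simp add: stage_def)
      have "sw \<beta> * Q n * pair_sum q t = sw \<beta> * Q n * pair_sum (cls \<beta>) t"
        using cls_n[OF \<beta>] by (cases "bit \<beta> n = bit (\<sigma> \<beta>) n") (auto simp: sw_def)
      moreover have "pow2_dvd ?e (psum N \<beta> t - psum N (\<sigma> \<beta>) t - sw \<beta> * Q n * pair_sum (cls \<beta>) t)"
        unfolding sw_def by (rule psum_split) (use \<sigma>[OF \<beta>] agree[OF \<beta>] nN[OF \<open>N \<ge> N0\<close>] in auto)
      ultimately show "pow2_dvd ?e (psum N \<beta> t - psum N (\<sigma> \<beta>) t - sw \<beta> * Q n * pair_sum q t)"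
        by (simp only:)
    qed
    finally have 1: "pow2_dvd ?e (Q m * ncoord N d t - a * (Q n * pair_sum q t))" .
    have 2: "pow2_dvd ?e (Q m * (ncoord N w t * Q (Suc n)))"
      by (intro pow2_dvd_int_mult Q_dvd) (use kw[OF that] in auto)
    have "Q m * ncoord N d t - a * (Q n * pair_sum q t) - Q m * (ncoord N w t * Q (Suc n))
        = Q n * (Q m * ncoord N p t - a * pair_sum q t)"
      by (simp add: ncoord_d algebra_simps)
    moreover have "?e = n * n + (2 * n + 1)" by simp
    ultimately have "pow2_dvd (n * n + (2 * n + 1)) (Q n * (Q m * ncoord N p t - a * pair_sum q t))"
      using pow2_dvd_diff[OF 1 2] by (simp only:)
    then have "pow2_dvd (n * n + (2 * n + 1)) (2 ^ (n * n) * (Q m * ncoord N p t - a * pair_sum q t))"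
      by (simp only: Q_def[of n])
    then have "pow2_dvd (2 * n + 1) (Q m * ncoord N p t - a * pair_sum q t)" by (rule pow2_dvd_cancel)
    then show ?thesis by (rule pow2_dvd_mono) simp
  qed
  then show ?thesis by blast
qed

text \<open>Two pigeonhole steps supply a suitable pair of branches. The first one, over uncountably many
branches of the class, fixes a single level \<open>m\<close> that controls denominators, size and separation of
the images; only then is the height \<open>K\<close> chosen, and the second one makes the branches and their
images indistinguishable up to that height.\<close>

lemma endo_pair_sum_approx:
  assumes \<phi>: "endo \<phi>"
  shows "\<exists>m. \<forall>K. \<exists>n\<ge>K. \<exists>a. \<exists>N0. \<forall>N\<ge>N0. \<forall>t.
           pow2_dvd n (Q m * ncoord N (\<phi> (of_nodes (pair_sum q))) t - a * pair_sum q t)"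
proof -
  define z where "z \<alpha> = \<phi> (branch_vec \<alpha>)" for \<alpha>
  have z_in: "z \<alpha> \<in> branch_group" if "\<alpha> \<in> I" for \<alpha>
    unfolding z_def by (rule endo_branch_group[OF \<phi> branch_vec_branch_group[OF that]])
  have "\<exists>m. z \<alpha> \<in> stage m \<and> separating {a. z \<alpha> a \<noteq> 0} m \<and> (\<forall>\<beta>. \<bar>z \<alpha> (Inr \<beta>)\<bar> < 2 ^ m)"
    if \<alpha>: "\<alpha> \<in> I" for \<alpha>
  proof -
    have fin: "finite {a. z \<alpha> a \<noteq> 0}" using z_in[OF \<alpha>] by (rule branch_group_supp)
    obtain m1 where m1: "\<And>N. N \<ge> m1 \<Longrightarrow> z \<alpha> \<in> stage N" using branch_group_level[OF z_in[OF \<alpha>]] by blast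
    obtain m2 where m2: "separating {a. z \<alpha> a \<noteq> 0} m2"
      using separating_exists[OF fin] branch_group_I[OF z_in[OF \<alpha>]] by blast
    obtain m3 where m3: "(\<Sum>a | z \<alpha> a \<noteq> 0. \<bar>z \<alpha> a\<bar>) < 2 ^ m3" using rat_less_pow2 by blast
    define m where "m = max m1 (max m2 m3)"
    have "\<bar>z \<alpha> (Inr \<beta>)\<bar> < 2 ^ m" for \<beta>
    proof (cases "z \<alpha> (Inr \<beta>) = 0")
      case False
      then have "\<bar>z \<alpha> (Inr \<beta>)\<bar> \<le> (\<Sum>a | z \<alpha> a \<noteq> 0. \<bar>z \<alpha> a\<bar>)"
        using member_le_sum[of "Inr \<beta>" "{a. z \<alpha> a \<noteq> 0}" "\<lambda>a. \<bar>z \<alpha> a\<bar>"] fin by simp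
      also note m3
      also have "(2::rat) ^ m3 \<le> 2 ^ m" by (rule power_increasing) (auto simp: m_def)
      finally show ?thesis .
    qed simp
    moreover have "z \<alpha> \<in> stage m" by (rule m1) (simp add: m_def)
    moreover have "separating {a. z \<alpha> a \<noteq> 0} m" by (rule separating_mono[OF m2]) (simp add: m_def)
    ultimately show ?thesis by blast
  qed
  then obtain \<nu> where \<nu>: "\<And>\<alpha>. \<alpha> \<in> I \<Longrightarrow> z \<alpha> \<in> stage (\<nu> \<alpha>) \<and> separating {a. z \<alpha> a \<noteq> 0} (\<nu> \<alpha>) \<and>
       (\<forall>\<beta>. \<bar>z \<alpha> (Inr \<beta>)\<bar> < 2 ^ (\<nu> \<alpha>))"
    by metis
  obtain m where m: "uncountable {\<alpha> \<in> {\<alpha> \<in> I. cls \<alpha> = q}. \<nu> \<alpha> = m}"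
    using uncountable_fiber[OF uncountable_cls[of q], of \<nu>] by auto
  define A where "A = {\<alpha> \<in> {\<alpha> \<in> I. cls \<alpha> = q}. \<nu> \<alpha> = m}"
  have "\<exists>n\<ge>K. \<exists>a. \<exists>N0. \<forall>N\<ge>N0. \<forall>t. pow2_dvd n (Q m * ncoord N (\<phi> (of_nodes (pair_sum q))) t - a * pair_sum q t)"
    for K
  proof -
    define K' where "K' = max K m"
    define shape where "shape \<alpha> = (\<lambda>\<beta>. (trunc \<beta> K', cls \<beta>, z \<alpha> (Inr \<beta>))) ` {\<beta>. z \<alpha> (Inr \<beta>) \<noteq> 0}" for \<alpha>
    define tpart where "tpart \<alpha> = (\<lambda>t. (t, z \<alpha> (Inl t))) ` {t. z \<alpha> (Inl t) \<noteq> 0}" for \<alpha>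
    \<comment> \<open>Everything recorded here ranges over a countable set, since supports are finite.\<close>
    define fp where "fp \<alpha> = (trunc \<alpha> K', shape \<alpha>, tpart \<alpha>)" for \<alpha>
    have fins: "finite (shape \<alpha>)" "finite (tpart \<alpha>)" if "\<alpha> \<in> I" for \<alpha>
      using branch_group_supp[OF z_in[OF that]] finite_Inr_supp[of "z \<alpha>"]
        finite_vimageI[of "{a. z \<alpha> a \<noteq> 0}" Inl]
      by (auto simp: shape_def tpart_def vimage_def)
    have "fp ` A \<subseteq> UNIV \<times> (Collect finite \<times> Collect finite)"
      using fins by (auto simp: fp_def A_def)
    moreover have "countable (UNIV \<times> (Collect finite \<times> Collect finite) ::
        (bool list \<times> (bool list \<times> (bool list \<times> bool list) \<times> rat) set \<times> (bool list \<times> rat) set) set)"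
      by (intro countable_SIGMA countable_Collect_finite) auto
    ultimately have "countable (fp ` A)" by (rule countable_subset)
    then obtain v where "uncountable {\<alpha> \<in> A. fp \<alpha> = v}"
      using uncountable_fiber m unfolding A_def[symmetric] by blast
    then have inf: "infinite {\<alpha> \<in> A. fp \<alpha> = v}" using uncountable_infinite by blast
    then obtain \<alpha>0 where \<alpha>0: "\<alpha>0 \<in> A" "fp \<alpha>0 = v" by (auto dest: infinite_imp_nonempty)
    from inf have "infinite ({\<alpha> \<in> A. fp \<alpha> = v} - {\<alpha>0})" by simp
    then obtain \<alpha>1 where "\<alpha>1 \<in> {\<alpha> \<in> A. fp \<alpha> = v} - {\<alpha>0}"
      using infinite_imp_nonempty by blast
    then have \<alpha>1: "\<alpha>1 \<in> A" "fp \<alpha>1 = v" "\<alpha>1 \<noteq> \<alpha>0" by auto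
    have "bit \<alpha>0 \<noteq> bit \<alpha>1" using bit_inj \<alpha>0 \<alpha>1 by (auto simp: A_def)
    then have ex: "\<exists>i. bit \<alpha>0 i \<noteq> bit \<alpha>1 i" by auto
    define n where "n = (LEAST i. bit \<alpha>0 i \<noteq> bit \<alpha>1 i)"
    have n: "bit \<alpha>0 n \<noteq> bit \<alpha>1 n" using ex unfolding n_def by (rule LeastI_ex)
    have agree01: "bit \<alpha>0 i = bit \<alpha>1 i" if "i < n" for i
      using not_less_Least that unfolding n_def by blast
    \<comment> \<open>Named so that the sign in front of the vector \<open>g\<close> is positive.\<close>
    obtain \<alpha> \<alpha>' where \<alpha>: "\<alpha> \<in> A" "\<alpha>' \<in> A" "fp \<alpha> = fp \<alpha>'" "bit \<alpha> n" "\<not> bit \<alpha>' n"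
        and agree: "\<And>i. i < n \<Longrightarrow> bit \<alpha> i = bit \<alpha>' i"
    proof (cases "bit \<alpha>0 n")
      case True
      show ?thesis by (rule that[of \<alpha>0 \<alpha>1]) (use True \<alpha>0 \<alpha>1 n agree01 in auto)
    next
      case False
      show ?thesis by (rule that[of \<alpha>1 \<alpha>0]) (use False \<alpha>0 \<alpha>1 n agree01 in auto)
    qed
    have I: "\<alpha> \<in> I" "\<alpha>' \<in> I" and cls: "cls \<alpha> = q" "cls \<alpha>' = q" and \<nu>m: "\<nu> \<alpha> = m" "\<nu> \<alpha>' = m"
      using \<alpha> by (auto simp: A_def)
    have "K' \<le> n" using \<alpha>(3,4,5) unfolding fp_def prod.inject trunc_eq_iff by (meson not_le)
    have "even n" using split_even[of \<alpha> \<alpha>' n] cls \<alpha> by simp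
    have sep: "separating {a. z \<alpha> a \<noteq> 0} K'" "separating {a. z \<alpha>' a \<noteq> 0} K'"
      using \<nu>[OF I(1)] \<nu>[OF I(2)] \<nu>m separating_mono[of _ m K'] by (auto simp: K'_def)
    have small: "\<bar>z \<alpha> (Inr \<beta>)\<bar> < 2 ^ K'" for \<beta>
    proof -
      have "\<bar>z \<alpha> (Inr \<beta>)\<bar> < 2 ^ m" using \<nu>[OF I(1)] \<nu>m by simp
      also have "(2::rat) ^ m \<le> 2 ^ K'" by (rule power_increasing) (auto simp: K'_def)
      finally show ?thesis .
    qed
    have injs: "inj_on (\<lambda>\<beta>. (trunc \<beta> K', cls \<beta>, z \<gamma> (Inr \<beta>))) {\<beta>. z \<gamma> (Inr \<beta>) \<noteq> 0}"
      if "separating {a. z \<gamma> a \<noteq> 0} K'" for \<gamma>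
      using that by (auto simp: inj_on_def separating_def)
    have "shape \<alpha> = shape \<alpha>'" using \<alpha>(3) by (simp add: fp_def)
    from bij_from_equal_images[OF injs[OF sep(1)] injs[OF sep(2)] this[unfolded shape_def]]
    obtain \<sigma> where \<sigma>: "bij_betw \<sigma> {\<beta>. z \<alpha> (Inr \<beta>) \<noteq> 0} {\<beta>. z \<alpha>' (Inr \<beta>) \<noteq> 0}"
      "\<And>\<beta>. z \<alpha> (Inr \<beta>) \<noteq> 0 \<Longrightarrow> trunc (\<sigma> \<beta>) K' = trunc \<beta> K' \<and> cls (\<sigma> \<beta>) = cls \<beta> \<and> z \<alpha>' (Inr (\<sigma> \<beta>)) = z \<alpha> (Inr \<beta>)"
      by auto
    have tpart_iff: "(t, r) \<in> tpart \<gamma> \<longleftrightarrow> r = z \<gamma> (Inl t) \<and> r \<noteq> 0" for t r \<gamma>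
      by (auto simp: tpart_def)
    have "tpart \<alpha> = tpart \<alpha>'" using \<alpha>(3) by (simp add: fp_def)
    then have Inl: "z \<alpha> (Inl t) = z \<alpha>' (Inl t)" for t
      using tpart_iff[of t "z \<alpha> (Inl t)"] tpart_iff[of t "z \<alpha>' (Inl t)"] by metis
    have cls_n: "cls \<beta> = q" if "z \<alpha> (Inr \<beta>) \<noteq> 0" "bit \<beta> n \<noteq> bit (\<sigma> \<beta>) n" for \<beta>
      using split_cls[of \<beta> "\<sigma> \<beta>" n \<alpha> \<alpha>'] \<sigma>(2)[OF that(1)] that(2) cls \<alpha>(4,5) by simp
    \<comment> \<open>By the agreement below \<open>n\<close>, dividing by \<open>Q (n + 1)\<close> stays inside the group.\<close>
    define w where "w a = (branch_vec \<alpha> a - branch_vec \<alpha>' a - Q n * of_nodes (pair_sum q) a) / Q (Suc n)" for a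
    have "w \<in> stage (Suc n)"
    proof -
      define w1 where "w1 = (\<lambda>a. 1 * branch_vec \<alpha> a + (- 1) * branch_vec \<alpha>' a)"
      have w1: "finite {a. w1 a \<noteq> 0}" unfolding w1_def by (intro finite_supp_lin finite_supp_branch_vec)
      have w_eq: "w = (\<lambda>a. (1 / Q (Suc n)) * w1 a + (- Q n / Q (Suc n)) * of_nodes (pair_sum q) a)"
        by (auto simp: w_def w1_def diff_divide_distrib)
      have fing: "finite {a. of_nodes (pair_sum q) a \<noteq> 0}" by (intro finite_supp_of_nodes finite_pair_sum)
      have "ncoord (Suc n) w t = (psum (Suc n) \<alpha> t - psum (Suc n) \<alpha>' t - Q n * pair_sum q t) / Q (Suc n)" for t
        unfolding w_eq ncoord_lin[OF w1 fing] unfolding w1_def ncoord_lin[OF finite_supp_branch_vec finite_supp_branch_vec]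
        by (simp add: diff_divide_distrib)
      moreover have "pow2_dvd (Suc n * Suc n) (psum (Suc n) \<alpha> t - psum (Suc n) \<alpha>' t - Q n * pair_sum q t)" for t
        using psum_split[of \<alpha> \<alpha>' n "Suc n" t] agree cls \<alpha> by simp
      ultimately have "Q (Suc n) * ncoord (Suc n) w t = psum (Suc n) \<alpha> t - psum (Suc n) \<alpha>' t - Q n * pair_sum q t"
          "pow2_dvd (Suc n * Suc n + 0) (psum (Suc n) \<alpha> t - psum (Suc n) \<alpha>' t - Q n * pair_sum q t)" for t
        by simp_all
      then have "ncoord (Suc n) w t \<in> \<int>" for t
        using pow2_dvd_cancel[of "Suc n * Suc n" 0 "ncoord (Suc n) w t"]
        unfolding Q_def[of "Suc n", symmetric] pow2_dvd_0_iff by simp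
      moreover have "finite {a. w a \<noteq> 0}" unfolding w_eq by (rule finite_supp_lin[OF w1 fing])
      ultimately show ?thesis using I by (auto simp: stage_def w_def)
    qed
    then have w: "w \<in> branch_group" by (rule stage_in_branch_group)
    have zz: "z \<alpha> a - z \<alpha>' a = Q n * \<phi> (of_nodes (pair_sum q)) a + Q (Suc n) * \<phi> w a" for a
    proof -
      have "(\<lambda>a. 1 * branch_vec \<alpha> a + (- 1) * branch_vec \<alpha>' a) = (\<lambda>a. Q n * of_nodes (pair_sum q) a + Q (Suc n) * w a)"
        by (auto simp: w_def)
      then have "\<phi> (\<lambda>a. 1 * branch_vec \<alpha> a + (- 1) * branch_vec \<alpha>' a) a = \<phi> (\<lambda>a. Q n * of_nodes (pair_sum q) a + Q (Suc n) * w a) a"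
        by (simp only:)
      then show ?thesis
        using endo_lin[OF \<phi> branch_vec_branch_group[OF I(1)] branch_vec_branch_group[OF I(2)], of 1 "- 1" a]
          endo_lin[OF \<phi> pair_sum_branch_group w Q_Ints Q_Ints, of n q "Suc n" a]
        by (simp add: z_def)
    qed
    have "\<exists>a. \<exists>N0. \<forall>N\<ge>N0. \<forall>t. pow2_dvd n (Q m * ncoord N (\<phi> (of_nodes (pair_sum q))) t - a * pair_sum q t)"
    proof (rule images_differ_along_line[where \<sigma> = \<sigma> and K = K' and w = "\<phi> w"])
      show "z \<alpha> \<in> stage m" using \<nu>[OF I(1)] \<nu>m by simp
      show "m \<le> K'" by (simp add: K'_def)
    qed (use z_in I sep small Inl \<sigma> cls_n zz \<open>K' \<le> n\<close> \<open>even n\<close> endo_branch_group[OF \<phi>] pair_sum_branch_group w in auto)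
    moreover have "K \<le> n" using \<open>K' \<le> n\<close> by (simp add: K'_def)
    ultimately show ?thesis by blast
  qed
  then show ?thesis by blast
qed

lemma endo_pair_sum:
  assumes "endo \<phi>"
  shows "\<phi> (of_nodes (pair_sum q)) (Inr \<beta>) = 0"
    and "pair_sum q t = 0 \<Longrightarrow> \<phi> (of_nodes (pair_sum q)) (Inl t) = 0"
    and "pair_sum q t = pair_sum q t' \<Longrightarrow> \<phi> (of_nodes (pair_sum q)) (Inl t) = \<phi> (of_nodes (pair_sum q)) (Inl t')"
proof -
  obtain m where m: "\<And>K. \<exists>n\<ge>K. \<exists>a. \<exists>N0. \<forall>N\<ge>N0. \<forall>t.
           pow2_dvd n (Q m * ncoord N (\<phi> (of_nodes (pair_sum q))) t - a * pair_sum q t)"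
    using endo_pair_sum_approx[OF assms] by blast
  have g: "pair_sum q t = 0" if "Suc (max (length (fst q)) (length (snd q))) \<le> length t" for t
    using that by (auto simp: pair_sum_def)
  note * = line_criterion[OF endo_branch_group[OF assms pair_sum_branch_group] Q_nonzero g m]
  show "\<phi> (of_nodes (pair_sum q)) (Inr \<beta>) = 0"
    "pair_sum q t = 0 \<Longrightarrow> \<phi> (of_nodes (pair_sum q)) (Inl t) = 0"
    "pair_sum q t = pair_sum q t' \<Longrightarrow> \<phi> (of_nodes (pair_sum q)) (Inl t) = \<phi> (of_nodes (pair_sum q)) (Inl t')"
    by (rule *; simp)+
qed

text \<open>The scalar of \<open>e\<^sub>t\<close> comes from \<open>g = 2 e\<^sub>t\<close>, and \<open>g = e\<^sub>s + e\<^sub>t\<close> forces the scalars of \<open>s\<close> and \<open>t\<close>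
to agree.\<close>

lemma endo_scalar_on_nodes:
  assumes \<phi>: "endo \<phi>"
  shows "\<exists>c. \<forall>t. \<phi> (node_vec t) = (\<lambda>a. c * node_vec t a)"
proof -
  have pair_sum_eq: "of_nodes (pair_sum (s, t)) = (\<lambda>a. node_vec s a + node_vec t a)" for s t
    by (rule ext) (auto simp: of_nodes_def pair_sum_def node_vec_def split: sum.splits)
  have sum: "\<phi> (of_nodes (pair_sum (s, t))) a = \<phi> (node_vec s) a + \<phi> (node_vec t) a" for s t a
    unfolding pair_sum_eq by (rule endo_add[OF \<phi> node_vec_branch_group node_vec_branch_group])
  have off: "\<phi> (node_vec t) a = 0" if "a \<noteq> Inl t" for t a
  proof (cases a)
    case (Inl s)
    then show ?thesis using endo_pair_sum(2)[OF \<phi>, of "(t, t)" s] sum[of t t a] that by (simp add: pair_sum_def)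
  next
    case (Inr \<beta>)
    then show ?thesis using endo_pair_sum(1)[OF \<phi>, of "(t, t)" \<beta>] sum[of t t a] by simp
  qed
  have same: "\<phi> (node_vec s) (Inl s) = \<phi> (node_vec t) (Inl t)" for s t
    using endo_pair_sum(3)[OF \<phi>, of "(s, t)" s t] sum[of s t "Inl s"] sum[of s t "Inl t"]
      off[of "Inl s" t] off[of "Inl t" s]
    by (cases "s = t") (auto simp: pair_sum_def)
  have "\<phi> (node_vec t) = (\<lambda>a. \<phi> (node_vec []) (Inl []) * node_vec t a)" for t
    using off[of _ t] same[of t "[]"] by (auto simp: node_vec_def)
  then show ?thesis by blast
qed

lemma endo_zero_of_nodes:
  assumes \<phi>: "endo \<phi>" and node_vec: "\<And>t. \<phi> (node_vec t) = (\<lambda>_. 0)"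
    and "finite T" "\<And>t. t \<notin> T \<Longrightarrow> b t = 0" "\<And>t. b t \<in> \<int>"
  shows "\<phi> (of_nodes b) a = 0"
  using assms(3-5)
proof (induction T arbitrary: b a rule: finite_induct)
  case empty
  then have "of_nodes b = (\<lambda>a. 0 * node_vec [] a)" by (auto simp: of_nodes_def split: sum.splits)
  then show ?case using endo_scale[OF \<phi> node_vec_branch_group, of 0 "[]" a] by (simp only:) simp
next
  case (insert t T)
  define b' where "b' = b(t := 0)"
  have b': "b' s = 0" if "s \<notin> T" for s using insert.prems(1)[of s] that by (auto simp: b'_def)
  have "finite {s. b' s \<noteq> 0}" by (rule finite_subset[OF _ \<open>finite T\<close>]) (use b' in blast)
  moreover have b'_Ints: "b' s \<in> \<int>" for s using insert.prems(2) by (simp add: b'_def)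
  ultimately have "of_nodes b' \<in> branch_group" by (rule of_nodes_branch_group)
  from endo_lin[OF \<phi> this node_vec_branch_group[of t] Ints_1 insert.prems(2)[of t], of a]
  have "\<phi> (\<lambda>a. 1 * of_nodes b' a + b t * node_vec t a) a = 0"
    using insert.IH[of b' a, OF b' b'_Ints] by (simp add: node_vec)
  moreover have "(\<lambda>a. 1 * of_nodes b' a + b t * node_vec t a) = of_nodes b"
    by (rule ext) (auto simp: of_nodes_def node_vec_def b'_def split: sum.splits)
  ultimately show ?case by (simp only:)
qed

text \<open>Modulo \<open>B\<close> every element is divisible by \<open>2\<^sup>n\<close>: subtracting the integral coordinates at a later
stage leaves a combination of the \<open>y\<^sub>\<beta>\<^sup>N\<close> with coefficients divisible by \<open>2\<^sup>n\<close>. So the image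
of the element is divisible by all powers of two.\<close>

lemma endo_zero:
  assumes \<phi>: "endo \<phi>" and node_vec: "\<And>t. \<phi> (node_vec t) = (\<lambda>_. 0)" and x: "x \<in> branch_group"
  shows "\<phi> x = (\<lambda>_. 0)"
proof (rule divisible_zero[OF endo_branch_group[OF \<phi> x]])
  fix n :: nat
  obtain m where m: "\<And>N. N \<ge> m \<Longrightarrow> x \<in> stage N" using branch_group_level[OF x] by blast
  have finx: "finite {a. x a \<noteq> 0}" using x by (rule branch_group_supp)
  \<comment> \<open>At this stage \<open>Q N\<close> exceeds \<open>Q m\<close> by a factor divisible by \<open>2 ^ n\<close>, because \<open>N\<^sup>2 \<ge> m\<^sup>2 + n\<close>.\<close>
  define N where "N = m + n"
  have xN: "x \<in> stage N" and xm: "x \<in> stage m" by (auto intro!: m simp: N_def)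
  define T where "T = {t. x (Inl t) \<noteq> 0} \<union> {t. set t \<subseteq> UNIV \<and> length t \<le> N} \<union>
      (\<Union>\<beta>\<in>{\<beta>. x (Inr \<beta>) \<noteq> 0}. {t. pair_sum (cls \<beta>) t \<noteq> 0})"
  have "finite {t. x (Inl t) \<noteq> 0}"
    using finite_vimageI[OF finx, of Inl] by (simp add: vimage_def)
  then have finT: "finite T"
    unfolding T_def by (intro finite_UnI finite_UN_I finite_lists_length_le finite_Inr_supp[OF finx] finite_pair_sum) auto
  have T: "ncoord N x t = 0" if "t \<notin> T" for t
  proof -
    have "x (Inr \<beta>) * psum N \<beta> t = 0" for \<beta>
      using that by (auto simp: T_def psum_def path_part_def)
    then have "(\<Sum>\<beta> | x (Inr \<beta>) \<noteq> 0. x (Inr \<beta>) * psum N \<beta> t) = 0" by (intro sum.neutral) blast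
    then show ?thesis using that by (simp add: ncoord_def T_def)
  qed
  have kI: "ncoord N x t \<in> \<int>" for t using xN by (simp add: stage_def)
  define b where "b = ncoord N x"
  have finb: "finite {t. b t \<noteq> 0}" by (rule finite_subset[OF _ finT]) (use T in \<open>auto simp: b_def\<close>)
  have bGG: "of_nodes b \<in> branch_group" by (rule of_nodes_branch_group[OF finb]) (simp add: b_def kI)
  define w where "w a = (x a - of_nodes b a) / 2 ^ n" for a
  have w_eq: "w = (\<lambda>a. (1 / 2 ^ n) * x a + (- 1 / 2 ^ n) * of_nodes b a)"
    by (auto simp: w_def diff_divide_distrib)
  have finb': "finite {a. of_nodes b a \<noteq> 0}" by (rule finite_supp_of_nodes[OF finb])
  have "w \<in> stage N"
  proof -
    have "finite {a. w a \<noteq> 0}" unfolding w_eq by (rule finite_supp_lin[OF finx finb'])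
    moreover have "ncoord N w t = 0" for t
      unfolding w_eq ncoord_lin[OF finx finb'] by (simp add: b_def)
    moreover have "Q N * w (Inr \<beta>) \<in> \<int>" for \<beta>
    proof -
      have "m * m + n \<le> m * m + n * n" by (simp only: nat_add_left_cancel_le le_square)
      also have "\<dots> \<le> N * N" by (simp add: N_def distrib_left distrib_right)
      finally have "N * N = m * m + (n + (N * N - m * m - n))" by simp
      then have "Q N = Q m * (2 ^ n * 2 ^ (N * N - m * m - n))"
        unfolding Q_def by (metis power_add)
      then have eq: "Q N * w (Inr \<beta>) = 2 ^ (N * N - m * m - n) * (Q m * x (Inr \<beta>))"
        by (simp add: w_def)
      show ?thesis unfolding eq by (rule Ints_mult) (use xm in \<open>auto simp: stage_def\<close>)
    qed
    moreover have "w (Inr \<beta>) = 0" if "\<beta> \<notin> I" for \<beta>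
      using xN that by (simp add: stage_def w_def)
    ultimately show ?thesis by (simp add: stage_def)
  qed
  then have w: "w \<in> branch_group" by (rule stage_in_branch_group)
  have "x = (\<lambda>a. 1 * of_nodes b a + 2 ^ n * w a)" by (simp add: w_def)
  moreover have "\<phi> (\<lambda>a. 1 * of_nodes b a + 2 ^ n * w a) a = 2 ^ n * \<phi> w a" for a
    using endo_lin[OF \<phi> bGG w, of 1 "2 ^ n" a] endo_zero_of_nodes[OF \<phi> node_vec finT, of b a] T kI
    by (simp add: b_def)
  ultimately have "\<phi> x = (\<lambda>a. 2 ^ n * \<phi> w a)" by metis
  then show "\<exists>w\<in>branch_group. \<phi> x = (\<lambda>a. 2 ^ n * w a)" using endo_branch_group[OF \<phi> w] by blast
qed

lemma branch_group_indecomposable: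
  assumes sub: "A \<subseteq> branch_group" "B \<subseteq> branch_group"
    and diffA: "\<And>x y. x \<in> A \<Longrightarrow> y \<in> A \<Longrightarrow> (\<lambda>a. x a - y a) \<in> A"
    and diffB: "\<And>x y. x \<in> B \<Longrightarrow> y \<in> B \<Longrightarrow> (\<lambda>a. x a - y a) \<in> B"
    and zero: "(\<lambda>_. 0) \<in> A" "(\<lambda>_. 0) \<in> B"
    and int: "A \<inter> B \<subseteq> {\<lambda>_. 0}"
    and sum: "\<And>x. x \<in> branch_group \<Longrightarrow> \<exists>a\<in>A. \<exists>b\<in>B. x = (\<lambda>i. a i + b i)"
  shows "A = {\<lambda>_. 0} \<or> B = {\<lambda>_. 0}"
proof -
  have addA: "(\<lambda>a. x a + y a) \<in> A" if "x \<in> A" "y \<in> A" for x y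
    using diffA[OF that(1) diffA[OF zero(1) that(2)]] by simp
  have addB: "(\<lambda>a. x a + y a) \<in> B" if "x \<in> B" "y \<in> B" for x y
    using diffB[OF that(1) diffB[OF zero(2) that(2)]] by simp
  obtain \<phi> where \<phi>: "\<And>x. x \<in> branch_group \<Longrightarrow> \<phi> x \<in> A \<and> (\<lambda>i. x i - \<phi> x i) \<in> B"
  proof -
    have "\<exists>a. a \<in> A \<and> (\<lambda>i. x i - a i) \<in> B" if x: "x \<in> branch_group" for x
    proof -
      obtain a b where "a \<in> A" "b \<in> B" "x = (\<lambda>i. a i + b i)" using sum[OF x] by blast
      then show ?thesis by (intro exI[of _ a]) simp
    qed
    then show ?thesis using that by metis
  qed
  have uniq: "a = \<phi> x" if "x \<in> branch_group" "a \<in> A" "(\<lambda>i. x i - a i) \<in> B" for x a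
  proof -
    have "(\<lambda>i. a i - \<phi> x i) \<in> A" using diffA that \<phi> by blast
    moreover have "(\<lambda>i. (x i - \<phi> x i) - (x i - a i)) \<in> B" using diffB[of "\<lambda>i. x i - \<phi> x i" "\<lambda>i. x i - a i"] that \<phi> by blast
    ultimately have "(\<lambda>i. a i - \<phi> x i) = (\<lambda>_. 0)" using int by auto
    then show ?thesis by (metis ext eq_iff_diff_eq_0)
  qed
  have padd: "\<phi> (\<lambda>a. x a + y a) = (\<lambda>a. \<phi> x a + \<phi> y a)" if "x \<in> branch_group" "y \<in> branch_group" for x y
  proof (rule uniq[symmetric])
    show "(\<lambda>a. x a + y a) \<in> branch_group" using that by (rule branch_group_add)
    show "(\<lambda>a. \<phi> x a + \<phi> y a) \<in> A" using addA \<phi> that by blast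
    have "(\<lambda>i. (x i - \<phi> x i) + (y i - \<phi> y i)) \<in> B" using addB[of "\<lambda>i. x i - \<phi> x i" "\<lambda>i. y i - \<phi> y i"] \<phi> that by blast
    then show "(\<lambda>i. x i + y i - (\<phi> x i + \<phi> y i)) \<in> B" by (simp add: algebra_simps)
  qed
  have endo1: "endo \<phi>" using \<phi> sub padd by (auto simp: endo_def)
  define \<psi> where "\<psi> x = (\<lambda>i. x i - \<phi> x i)" for x
  have endo2: "endo \<psi>" using \<phi> sub padd by (auto simp: endo_def \<psi>_def)
  have fixA: "\<phi> x = x" if "x \<in> A" for x
    using uniq[of x x] that sub zero by auto
  have fixB: "\<phi> x = (\<lambda>_. 0)" if "x \<in> B" for x
    using uniq[of x "\<lambda>_. 0"] that sub zero by auto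
  obtain c where c: "\<And>t. \<phi> (node_vec t) = (\<lambda>a. c * node_vec t a)" using endo_scalar_on_nodes[OF endo1] by blast
  have "c \<in> \<int>"
  proof -
    obtain m where "\<phi> (node_vec []) \<in> stage m" using endo_branch_group[OF endo1 node_vec_branch_group] unfolding branch_group_def by blast
    then have "ncoord m (\<phi> (node_vec [])) [] \<in> \<int>" by (simp add: stage_def)
    then show ?thesis by (simp add: c ncoord_def)
  qed
  \<comment> \<open>The integer scalar of a projection is idempotent.\<close>
  have "\<phi> (\<phi> (node_vec [])) = \<phi> (node_vec [])" using \<phi>[OF node_vec_branch_group] fixA by blast
  then have "\<phi> (\<lambda>a. c * node_vec [] a) (Inl []) = c" by (simp add: c)
  then have "c * c = c"
    using endo_scale[OF endo1 node_vec_branch_group \<open>c \<in> \<int>\<close>, of "[]" "Inl []"] c[of "[]"] by simp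
  then consider "c = 0" | "c = 1" by auto
  then show ?thesis
  proof cases
    case 1
    then have "\<phi> x = (\<lambda>_. 0)" if "x \<in> branch_group" for x using endo_zero[OF endo1 _ that] c by simp
    then have "x = (\<lambda>_. 0)" if "x \<in> A" for x using fixA[OF that] subsetD[OF sub(1) that] by simp
    then have "A \<subseteq> {\<lambda>_. 0}" by blast
    then show ?thesis using zero by blast
  next
    case 2
    have \<psi>0: "\<psi> x = (\<lambda>_. 0)" if "x \<in> branch_group" for x
      by (rule endo_zero[OF endo2 _ that]) (simp add: \<psi>_def c 2)
    have "x = (\<lambda>_. 0)" if "x \<in> B" for x
    proof -
      have "\<psi> x = x" using fixB[OF that] by (simp add: \<psi>_def)
      then show ?thesis using \<psi>0 sub(2) that by auto
    qed
    then have "B \<subseteq> {\<lambda>_. 0}" by blast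
    then show ?thesis using zero by blast
  qed
qed

section \<open>Copies of the group on other carriers\<close>

text \<open>The group carried over to another carrier along a bijection, so that it can be placed on a type of
one's choice.\<close>

definition transport :: "('c \<Rightarrow> bool list + 'i \<Rightarrow> rat) \<Rightarrow> 'c set \<Rightarrow> 'c monoid" where
  "transport j Y = \<lparr>carrier = Y, monoid.mult = \<lambda>x y. inv_into Y j (\<lambda>a. j x a + j y a),
                one = inv_into Y j (\<lambda>_. 0)\<rparr>"

context
  fixes j :: "'c \<Rightarrow> bool list + 'i \<Rightarrow> rat" and Y :: "'c set"
  assumes bij: "bij_betw j Y branch_group"
begin

lemma carrier_transport [simp]: "carrier (transport j Y) = Y"
  by (simp add: transport_def)

lemma j_branch_group: "x \<in> Y \<Longrightarrow> j x \<in> branch_group"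
  using bij by (auto simp: bij_betw_def)

lemma j_inv: "z \<in> branch_group \<Longrightarrow> inv_into Y j z \<in> Y \<and> j (inv_into Y j z) = z"
  using bij by (metis bij_betw_imp_surj_on f_inv_into_f inv_into_into)

lemma j_eq: "x \<in> Y \<Longrightarrow> y \<in> Y \<Longrightarrow> j x = j y \<Longrightarrow> x = y"
  using bij by (auto simp: bij_betw_def inj_on_def)

lemma transport_mult:
  assumes "x \<in> Y" "y \<in> Y"
  shows "x \<otimes>\<^bsub>transport j Y\<^esub> y \<in> Y" "j (x \<otimes>\<^bsub>transport j Y\<^esub> y) = (\<lambda>a. j x a + j y a)"
  using j_inv[OF branch_group_add[OF j_branch_group j_branch_group, OF assms]] by (simp_all add: transport_def)

lemma transport_one: "\<one>\<^bsub>transport j Y\<^esub> \<in> Y" "j \<one>\<^bsub>transport j Y\<^esub> = (\<lambda>_. 0)"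
  using j_inv[OF branch_group_zero] by (simp_all add: transport_def)

lemma transport_comm_group: "comm_group (transport j Y)"
proof (rule comm_groupI)
  fix x assume "x \<in> carrier (transport j Y)"
  then have x: "x \<in> Y" by simp
  define y where "y = inv_into Y j (\<lambda>a. - j x a)"
  have "(\<lambda>a. - j x a) \<in> branch_group" using branch_group_scale[OF j_branch_group[OF x], of "- 1"] by simp
  then have y: "y \<in> Y" "j y = (\<lambda>a. - j x a)" using j_inv by (auto simp: y_def)
  have "y \<otimes>\<^bsub>transport j Y\<^esub> x = \<one>\<^bsub>transport j Y\<^esub>"
    by (rule j_eq) (use x y in \<open>auto simp: transport_mult transport_one\<close>)
  then show "\<exists>y\<in>carrier (transport j Y). y \<otimes>\<^bsub>transport j Y\<^esub> x = \<one>\<^bsub>transport j Y\<^esub>" using y by auto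
qed (auto simp: transport_mult transport_one intro!: j_eq)

lemma transport_inv:
  assumes "x \<in> Y" shows "j (inv\<^bsub>transport j Y\<^esub> x) = (\<lambda>a. - j x a)"
proof -
  interpret comm_group "transport j Y" by (rule transport_comm_group)
  have "inv\<^bsub>transport j Y\<^esub> x \<in> Y" "x \<otimes>\<^bsub>transport j Y\<^esub> inv\<^bsub>transport j Y\<^esub> x = \<one>\<^bsub>transport j Y\<^esub>"
    using assms inv_closed[of x] r_inv[of x] by auto
  then have "j x a + j (inv\<^bsub>transport j Y\<^esub> x) a = 0" for a
    using transport_mult(2)[of x "inv\<^bsub>transport j Y\<^esub> x"] transport_one(2) assms by metis
  then show ?thesis by (auto simp: eq_neg_iff_add_eq_0 add.commute)
qed

lemma transport_aleph1_free: "aleph1_free (transport j Y)"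
  unfolding aleph1_free_def
proof (intro allI impI, elim conjE)
  fix H assume H: "subgroup H (transport j Y)" and "countable H"
  have HX: "H \<subseteq> Y" using subgroup.subset[OF H] by simp
  \<comment> \<open>Adding all nodes makes the set of coordinates infinite, so that it is enumerated without repetition.\<close>
  define J where "J = range Inl \<union> (\<Union>x\<in>H. {a. j x a \<noteq> 0})"
  have "countable {a. j x a \<noteq> 0}" if "x \<in> H" for x
    using that HX by (intro countable_finite branch_group_supp j_branch_group) auto
  then have "countable (\<Union>x\<in>H. {a. j x a \<noteq> 0})"
    using \<open>countable H\<close> by (rule_tac countable_UN)
  then have "countable J" unfolding J_def by (intro countable_Un) auto
  moreover have "infinite J"
  proof -
    have "infinite (UNIV :: bool list set)" by (rule infinite_UNIV_listI)
    then have "infinite (range Inl :: (bool list + 'i) set)"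
      by (simp add: finite_image_iff)
    then show ?thesis unfolding J_def by (meson finite_subset Un_upper1)
  qed
  ultimately have fJ: "bij_betw (from_nat_into J) UNIV J" by (rule bij_betw_from_nat_into)
  define co where "co x n = j x (from_nat_into J n)" for x n
  let ?K = "(transport j Y)\<lparr>carrier := H\<rparr>"
  show "free_abelian ?K"
  proof (rule free_abelian_coords[where co = co])
    show "comm_group ?K"
    proof (rule group.group_comm_groupI)
      show "group ?K" using transport_comm_group H by (intro subgroup.subgroup_is_group comm_group.axioms)
      show "x \<otimes>\<^bsub>?K\<^esub> y = y \<otimes>\<^bsub>?K\<^esub> x" if "x \<in> carrier ?K" "y \<in> carrier ?K" for x y
        using that HX by (auto intro!: j_eq simp: transport_mult add.commute subset_iff)
    qed
    show "co (x \<otimes>\<^bsub>?K\<^esub> y) n = co x n + co y n" if "x \<in> carrier ?K" "y \<in> carrier ?K" for x y n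
      using that subsetD[OF HX] transport_mult(2)[of x y] by (auto simp: co_def)
    show "x = \<one>\<^bsub>?K\<^esub>" if x: "x \<in> carrier ?K" and 0: "\<And>n. co x n = 0" for x
    proof -
      have xH: "x \<in> H" using x by simp
      have "j x a = 0" for a
      proof (cases "a \<in> J")
        case True
        then obtain n where "a = from_nat_into J n" using fJ by (auto simp: bij_betw_def)
        then show ?thesis using 0[of n] by (simp add: co_def)
      qed (use xH in \<open>auto simp: J_def\<close>)
      then have "x = \<one>\<^bsub>transport j Y\<^esub>" using xH HX by (intro j_eq) (auto simp: transport_one)
      then show ?thesis by simp
    qed
    show "\<exists>N. \<forall>n\<ge>N. co x n = 0" if "x \<in> carrier ?K" for x
    proof -
      have "finite {a. j x a \<noteq> 0}" using that HX by (intro branch_group_supp j_branch_group) auto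
      then have "finite (from_nat_into J -` {a. j x a \<noteq> 0})"
        using fJ by (intro finite_vimageI) (auto simp: bij_betw_def)
      then obtain N where "\<forall>n\<in>from_nat_into J -` {a. j x a \<noteq> 0}. n < N"
        using finite_nat_set_iff_bounded by blast
      then have "\<forall>n\<ge>N. co x n = 0" unfolding co_def by (auto simp: linorder_not_less[symmetric])
      then show ?thesis ..
    qed
    show "\<exists>D::int. D \<noteq> 0 \<and> (\<forall>x\<in>carrier ?K. (\<forall>n>N. co x n = 0) \<longrightarrow> of_int D * co x N \<in> \<int>)" for N
    proof -
      obtain D :: int where D: "D \<noteq> 0" "\<And>x a. x \<in> branch_group \<Longrightarrow> (\<And>a. a \<notin> from_nat_into J ` {..N} \<Longrightarrow> x a = 0) \<Longrightarrow> of_int D * x a \<in> \<int>"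
        using bounded_denominators[of "from_nat_into J ` {..N}"] by auto
      have "of_int D * co x N \<in> \<int>" if x: "x \<in> H" and 0: "\<And>n. n > N \<Longrightarrow> co x n = 0" for x
        unfolding co_def
      proof (rule D(2))
        show "j x \<in> branch_group" using x HX j_branch_group by blast
        fix a assume a: "a \<notin> from_nat_into J ` {..N}"
        show "j x a = 0"
        proof (cases "a \<in> J")
          case True
          then obtain n where "a = from_nat_into J n" using fJ by (auto simp: bij_betw_def)
          then show ?thesis using 0[of n] a by (cases "n \<le> N") (auto simp: co_def)
        qed (use x in \<open>auto simp: J_def\<close>)
      qed
      then show ?thesis using D(1) by auto
    qed
  qed
qed

lemma transport_indecomposable: "indecomposable (transport j Y)"
  unfolding indecomposable_def
proof (intro conjI notI)
  interpret comm_group "transport j Y" by (rule transport_comm_group)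
  assume "carrier (transport j Y) = {\<one>\<^bsub>transport j Y\<^esub>}"
  then have "inv_into Y j (node_vec []) = \<one>\<^bsub>transport j Y\<^esub>" using j_inv[OF node_vec_branch_group, of "[]"] by auto
  then have "j (inv_into Y j (node_vec [])) = (\<lambda>_. 0)" using transport_one by simp
  then have "node_vec [] (Inl []) = 0" using j_inv[OF node_vec_branch_group, of "[]"] by metis
  then show False by simp
next
  interpret comm_group "transport j Y" by (rule transport_comm_group)
  assume "\<exists>A B. internal_direct_sum (transport j Y) A B \<and> A \<noteq> {\<one>\<^bsub>transport j Y\<^esub>} \<and> B \<noteq> {\<one>\<^bsub>transport j Y\<^esub>}"
  then obtain A B where A: "subgroup A (transport j Y)" and B: "subgroup B (transport j Y)"
    and int: "A \<inter> B = {\<one>\<^bsub>transport j Y\<^esub>}" and sum: "A <#>\<^bsub>transport j Y\<^esub> B = Y"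
    and ne: "A \<noteq> {\<one>\<^bsub>transport j Y\<^esub>}" "B \<noteq> {\<one>\<^bsub>transport j Y\<^esub>}"
    by (auto simp: internal_direct_sum_def)
  have AX: "A \<subseteq> Y" and BX: "B \<subseteq> Y" using subgroup.subset[OF A] subgroup.subset[OF B] by auto
  have diff: "(\<lambda>a. x a - y a) \<in> j ` C" if C: "subgroup C (transport j Y)" and xy: "x \<in> j ` C" "y \<in> j ` C" for C x y
  proof -
    have CX: "C \<subseteq> Y" using subgroup.subset[OF C] by simp
    obtain u v where uv: "u \<in> C" "v \<in> C" "x = j u" "y = j v" using xy by auto
    have inv: "inv\<^bsub>transport j Y\<^esub> v \<in> C" by (rule subgroup.m_inv_closed[OF C uv(2)])
    have Y: "u \<in> Y" "v \<in> Y" "inv\<^bsub>transport j Y\<^esub> v \<in> Y" using uv inv CX by blast+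
    have "(\<lambda>a. x a - y a) = j (u \<otimes>\<^bsub>transport j Y\<^esub> inv\<^bsub>transport j Y\<^esub> v)"
      by (simp add: transport_mult(2)[OF Y(1,3)] transport_inv[OF Y(2)] uv(3,4))
    then show ?thesis using subgroup.m_closed[OF C uv(1) inv] by (rule image_eqI)
  qed
  have zero: "(\<lambda>_. 0) \<in> j ` C" if "subgroup C (transport j Y)" for C
    using transport_one(2)[symmetric] subgroup.one_closed[OF that] by (rule image_eqI)
  have "j ` A = {\<lambda>_. 0} \<or> j ` B = {\<lambda>_. 0}"
  proof (rule branch_group_indecomposable)
    show "j ` A \<subseteq> branch_group" "j ` B \<subseteq> branch_group" using AX BX j_branch_group by auto
    show "j ` A \<inter> j ` B \<subseteq> {\<lambda>_. 0}"
    proof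
      fix z assume "z \<in> j ` A \<inter> j ` B"
      then obtain u v where uv: "u \<in> A" "v \<in> B" "z = j u" "z = j v" by auto
      then have "u = v" using AX BX by (intro j_eq) auto
      then have "u \<in> A \<inter> B" using uv by simp
      then have "u = \<one>\<^bsub>transport j Y\<^esub>" unfolding int by simp
      then show "z \<in> {\<lambda>_. 0}" using uv(3) transport_one(2) by simp
    qed
    show "\<exists>a\<in>j ` A. \<exists>b\<in>j ` B. x = (\<lambda>i. a i + b i)" if "x \<in> branch_group" for x
    proof -
      have "inv_into Y j x \<in> A <#>\<^bsub>transport j Y\<^esub> B" using j_inv[OF that] sum by simp
      then obtain u v where uv: "u \<in> A" "v \<in> B" "inv_into Y j x = u \<otimes>\<^bsub>transport j Y\<^esub> v"
        by (auto simp: set_mult_def)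
      then have "x = (\<lambda>i. j u i + j v i)"
        using transport_mult(2)[of u v] j_inv[OF that] AX BX by auto
      then show ?thesis using uv by blast
    qed
  qed (use diff[OF A] diff[OF B] zero[OF A] zero[OF B] in auto)
  moreover have "C = {\<one>\<^bsub>transport j Y\<^esub>}" if C: "subgroup C (transport j Y)" and "j ` C = {\<lambda>_. 0}" for C
  proof -
    have "C \<subseteq> Y" using subgroup.subset[OF C] by simp
    then have "x = \<one>\<^bsub>transport j Y\<^esub>" if "x \<in> C" for x
      using that \<open>j ` C = {\<lambda>_. 0}\<close> by (intro j_eq) (auto simp: transport_one)
    then show ?thesis using subgroup.one_closed[OF C] by blast
  qed
  ultimately show False using A B ne by blast
qed

end

end

section \<open>A system of branches of size aleph-1\<close>

definition \<omega>1 :: "nat set set" where "\<omega>1 = Field (cardSuc natLeq)"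

lemma card_\<omega>1: "( |\<omega>1|, cardSuc natLeq) \<in> ordIso"
  unfolding \<omega>1_def by (rule card_of_Field_ordIso[OF cardSuc_Card_order[OF natLeq_Card_order]])

lemma countable_le_natLeq:
  assumes "countable A" shows "|A| \<le>o natLeq"
proof -
  obtain f :: "'a \<Rightarrow> nat" where "inj_on f A" using assms by (auto simp: countable_def)
  then have "|A| \<le>o |UNIV :: nat set|" by (intro card_of_ordLeqI) auto
  then show ?thesis using card_of_nat by (rule ordLeq_ordIso_trans)
qed

lemma countable_le_cardSuc_natLeq: "countable A \<Longrightarrow> |A| \<le>o cardSuc natLeq"
  using countable_le_natLeq cardSuc_ordLeq[OF natLeq_Card_order] ordLeq_transitive by blast

lemma uncountable_\<omega>1: "uncountable \<omega>1"
proof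
  assume "countable \<omega>1"
  then have "|\<omega>1| \<le>o natLeq" by (rule countable_le_natLeq)
  then have "cardSuc natLeq \<le>o natLeq" using card_\<omega>1 by (metis ordIso_ordLeq_trans ordIso_symmetric)
  then show False
    using cardSuc_greater[OF natLeq_Card_order] not_ordLess_ordLeq by blast
qed

text \<open>A branch with label \<open>(p, S)\<close> announces its class at the odd levels and spells out \<open>S\<close> at the even
levels reserved for \<open>p\<close>; so branches with the same \<open>p\<close> part only at such even levels.\<close>

definition branch_bit :: "(bool list \<times> bool list) \<times> nat set \<Rightarrow> nat \<Rightarrow> bool" where
  "branch_bit \<beta> n = (if even n then fst (prod_decode (n div 2)) = to_nat (fst \<beta>) \<and> snd (prod_decode (n div 2)) \<in> snd \<beta>
                else n div 2 = to_nat (fst \<beta>))"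

lemma branch_bit_split:
  assumes "fst \<beta> = fst \<gamma>" "branch_bit \<beta> n \<noteq> branch_bit \<gamma> n"
  shows "even n" "fst (prod_decode (n div 2)) = to_nat (fst \<beta>)"
  using assms by (auto simp: branch_bit_def split: if_splits)

interpretation branches "UNIV \<times> \<omega>1" branch_bit fst
proof
  fix \<beta> \<gamma> :: "(bool list \<times> bool list) \<times> nat set"
  assume eq: "branch_bit \<beta> = branch_bit \<gamma>"
  have "branch_bit \<gamma> (2 * to_nat (fst \<beta>) + 1)" unfolding eq[symmetric] by (simp add: branch_bit_def)
  then have p: "fst \<beta> = fst \<gamma>" by (simp add: branch_bit_def)
  have "j \<in> snd \<beta> \<longleftrightarrow> j \<in> snd \<gamma>" for j
    using fun_cong[OF eq, of "2 * prod_encode (to_nat (fst \<beta>), j)"] p by (simp add: branch_bit_def)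
  then show "\<beta> = \<gamma>" using p by (auto simp: prod_eq_iff)
next
  fix p :: "bool list \<times> bool list"
  have eq: "{\<beta> \<in> UNIV \<times> \<omega>1. fst \<beta> = p} = Pair p ` \<omega>1" by auto
  have "countable \<omega>1" if "countable (Pair p ` \<omega>1)"
    using that by (rule countable_image_inj_on) (auto simp: inj_on_def)
  then show "uncountable {\<beta> \<in> UNIV \<times> \<omega>1. fst \<beta> = p}" unfolding eq using uncountable_\<omega>1 by blast
next
  fix \<beta> \<beta>' \<gamma> \<gamma>' :: "(bool list \<times> bool list) \<times> nat set" and n
  assume "fst \<beta> = fst \<beta>'" "branch_bit \<beta> n \<noteq> branch_bit \<beta>' n" "fst \<gamma> = fst \<gamma>'" "branch_bit \<gamma> n \<noteq> branch_bit \<gamma>' n"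
  then show "fst \<beta> = fst \<gamma>" using branch_bit_split(2)[of \<beta> \<beta>' n] branch_bit_split(2)[of \<gamma> \<gamma>' n] by simp
qed (use branch_bit_split in blast)

lemma card_branch_group: "|branch_group| =o |\<omega>1|"
proof -
  let ?r = "cardSuc natLeq :: nat set rel"
  have r: "Card_order ?r" by (rule cardSuc_Card_order[OF natLeq_Card_order])
  have inf: "infinite (Field ?r)" using uncountable_infinite[OF uncountable_\<omega>1] by (simp add: \<omega>1_def)
  have \<omega>1: "|\<omega>1| \<le>o ?r" using card_\<omega>1 by (rule ordIso_imp_ordLeq)
  let ?A = "((UNIV :: bool list set) <+> ((UNIV :: (bool list \<times> bool list) set) \<times> \<omega>1)) \<times> (UNIV :: rat set)"
  have "|?A| \<le>o ?r"
    by (intro card_of_Times_ordLeq_infinite_Field card_of_Plus_ordLeq_infinite_Field inf r \<omega>1 countable_le_cardSuc_natLeq) auto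
  moreover have "infinite ?A"
  proof -
    have "infinite (UNIV :: rat set)" by (rule infinite_UNIV_char_0)
    then show ?thesis by (auto simp: finite_cartesian_product_iff Plus_eq_empty_conv)
  qed
  ultimately have Fp: "|Fpow ?A| \<le>o ?r"
    using card_of_Fpow_infinite ordIso_ordLeq_trans by blast
  define gr where "gr x = (\<lambda>a. (a, x a)) ` {a. x a \<noteq> 0}"
    for x :: "bool list + (bool list \<times> bool list) \<times> nat set \<Rightarrow> rat"
  have gr_iff: "(a, r) \<in> gr x \<longleftrightarrow> r = x a \<and> r \<noteq> 0" for a r x by (auto simp: gr_def)
  have "inj_on gr branch_group"
  proof (rule inj_onI, rule ext)
    fix x y a assume "gr x = gr y"
    then show "x a = y a" using gr_iff[of a "x a"] gr_iff[of a "y a"] by metis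
  qed
  moreover have "gr x \<in> Fpow ?A" if "x \<in> branch_group" for x
  proof -
    have "finite (gr x)" using branch_group_supp[OF that] by (simp add: gr_def)
    moreover have "a \<in> UNIV <+> (UNIV \<times> \<omega>1)" if "x a \<noteq> 0" for a
      using that branch_group_I[OF \<open>x \<in> branch_group\<close>] by (cases a) auto
    ultimately show ?thesis by (auto simp: Fpow_def gr_def)
  qed
  ultimately have "|branch_group| \<le>o |Fpow ?A|" by (intro card_of_ordLeqI) auto
  then have "|branch_group| \<le>o ?r" using Fp by (rule ordLeq_transitive)
  then have 1: "|branch_group| \<le>o |\<omega>1|" using card_\<omega>1 ordIso_symmetric ordLeq_ordIso_trans by blast
  have "inj_on (\<lambda>S. branch_vec (([], []), S)) \<omega>1"
  proof (rule inj_onI)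
    fix S T assume "branch_vec (([], []), S) = branch_vec (([], []), T)"
    from fun_cong[OF this, of "Inr (([], []), S)"] show "S = T" by (simp split: if_splits)
  qed
  then have "|\<omega>1| \<le>o |branch_group|" by (rule card_of_ordLeqI) (auto intro: branch_vec_branch_group)
  with 1 show ?thesis by (simp add: ordIso_iff_ordLeq)
qed

theorem mainTheorem2:
  shows "\<exists>G :: nat set monoid. comm_group G \<and> has_card_aleph1 (carrier G) \<and>
           aleph1_free G \<and> indecomposable G"
proof -
  have "|\<omega>1| =o |branch_group|" using card_branch_group by (rule ordIso_symmetric)
  then obtain j where j: "bij_betw j \<omega>1 branch_group" using card_of_ordIso by blast
  have "has_card_aleph1 (carrier (transport j \<omega>1))"
    unfolding has_card_aleph1_def carrier_transport[OF j] by (rule card_\<omega>1)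
  then show ?thesis
    using transport_comm_group[OF j] transport_aleph1_free[OF j] transport_indecomposable[OF j] by blast
qed

end
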